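(* Let $\alpha\in(0,\frac{\pi}{2})$ and $m>0$, and let $S_0$ be the Robin Laplacian with parameter $\beta=2\cot(\alpha)$. If $z\in\rho(S_0)$, then, for all sufficiently large $c>0$, $z\in\rho(D_{0,c}-mc^2)$, and $$\lim_{c\to+\infty}\left\|(D_{0,c}-mc^2-z)^{-1}-\begin{pmatrix}(S_0-z)^{-1}&0\\0&0\end{pmatrix}\right\|=0 ,$$ where the norm is the operator norm on $L^2((0,\infty),\mathbb{C}^2)$.
   Context: For $c>0$, $D_{0,c}$ is the operator in $L^2((0,\infty),\mathbb{C}^2)$ acting as $$D_{0,c}=\begin{pmatrix} mc^2 & -c\frac{d}{dx}\\ c\frac{d}{dx} & -mc^2\end{pmatrix}$$ with domain $$\mathrm{dom}(D_{0,c})=\Big\{\psi=(\psi_1,\psi_2)^\top\in H^1((0,\infty),\mathbb{C}^2):\ \psi_1(0)\,\frac{\cot(\alpha)}{mc}=\psi_2(0)\Big\}.$$ For $\beta\in(0,+\infty)$, the Robin Laplacian is the self-adjoint operator $S_0=-\frac{1}{2m}\frac{d^2}{dx^2}$ in $L^2((0,\infty))$ with domain consisting of the functions $\psi\in H^2((0,\infty))$ satisfying $\psi'(0)=\beta\psi(0)$. *)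

theory Defs
  imports "HOL-Analysis.Analysis"
begin

section \<open>Complex normed spaces\<close>

text \<open>The distribution has only real normed spaces; resolvents at non-real points also need
  multiplication by complex scalars.\<close>

class complex_normed_vector = real_normed_vector +
  fixes scaleC :: "complex \<Rightarrow> 'a \<Rightarrow> 'a"  (infixr \<open>*\<^sub>C\<close> 75)
  assumes scaleC_add_right: "a *\<^sub>C (x + y) = a *\<^sub>C x + a *\<^sub>C y"
    and scaleC_add_left: "(a + b) *\<^sub>C x = a *\<^sub>C x + b *\<^sub>C x"
    and scaleC_scaleC: "a *\<^sub>C b *\<^sub>C x = (a * b) *\<^sub>C x"
    and scaleC_of_real: "complex_of_real r *\<^sub>C x = r *\<^sub>R x"
    and norm_scaleC: "norm (a *\<^sub>C x) = cmod a * norm x"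

instantiation prod :: (complex_normed_vector, complex_normed_vector) complex_normed_vector
begin

definition scaleC_prod_def: "a *\<^sub>C x = (a *\<^sub>C fst x, a *\<^sub>C snd x)"

instance
proof
  fix a b :: complex and r :: real and x y :: "'a \<times> 'b"
  show "a *\<^sub>C (x + y) = a *\<^sub>C x + a *\<^sub>C y"
    by (simp add: scaleC_prod_def scaleC_add_right)
  show "(a + b) *\<^sub>C x = a *\<^sub>C x + b *\<^sub>C x"
    by (simp add: scaleC_prod_def scaleC_add_left)
  show "a *\<^sub>C b *\<^sub>C x = (a * b) *\<^sub>C x"
    by (simp add: scaleC_prod_def scaleC_scaleC)
  show "complex_of_real r *\<^sub>C x = r *\<^sub>R x"
    by (simp add: scaleC_prod_def scaleC_of_real scaleR_prod_def)
  show "norm (a *\<^sub>C x) = cmod a * norm x"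
    by (simp add: scaleC_prod_def norm_prod_def norm_scaleC power_mult_distrib
        distrib_left [symmetric] real_sqrt_mult)
qed

end


section \<open>The space $L^2((0,\infty))$\<close>

text \<open>Every Lebesgue measurable function agrees almost everywhere with a Borel measurable one, so
  working with Borel representatives gives the usual space.\<close>

definition halfline :: "real measure" where
  "halfline = restrict_space lborel {0<..}"

definition square_integrable :: "(real \<Rightarrow> complex) \<Rightarrow> bool" where
  "square_integrable f \<longleftrightarrow>
     f \<in> borel_measurable halfline \<and> integrable halfline (\<lambda>x. (cmod (f x))\<^sup>2)"

lemma square_integrable_zero: "square_integrable (\<lambda>x. 0)"
  by (simp add: square_integrable_def)

lemma square_integrable_cmult:
  assumes "square_integrable f"
  shows "square_integrable (\<lambda>x. a * f x)"
  using assms by (auto simp: square_integrable_def norm_mult power_mult_distrib)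

lemma cmod_add_power2_le:
  assumes "0 < t"
  shows "(cmod (u + v))\<^sup>2 \<le> (1 + t) * (cmod u)\<^sup>2 + (1 + 1 / t) * (cmod v)\<^sup>2"
proof -
  define p q where "p = cmod u" and "q = cmod v"
  have "0 \<le> (t * p - q)\<^sup>2 / t"
    using assms by simp
  also have "\<dots> = t * p\<^sup>2 - 2 * p * q + q\<^sup>2 / t"
    using assms by (simp add: field_simps power2_eq_square)
  finally have "(p + q)\<^sup>2 \<le> (1 + t) * p\<^sup>2 + (1 + 1 / t) * q\<^sup>2"
    by (simp add: algebra_simps power2_eq_square)
  moreover have "(cmod (u + v))\<^sup>2 \<le> (p + q)\<^sup>2"
    unfolding p_def q_def by (rule power_mono [OF norm_triangle_ineq norm_ge_zero])
  ultimately show ?thesis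
    unfolding p_def q_def by (rule order_trans [rotated])
qed

lemma square_integrable_add:
  assumes "square_integrable f" "square_integrable g"
  shows "square_integrable (\<lambda>x. f x + g x)"
proof -
  have m [measurable]: "f \<in> borel_measurable halfline" "g \<in> borel_measurable halfline"
    using assms by (auto simp: square_integrable_def)
  have "integrable halfline (\<lambda>x. (cmod (f x + g x))\<^sup>2)"
  proof (rule Bochner_Integration.integrable_bound)
    show "integrable halfline (\<lambda>x. 2 * (cmod (f x))\<^sup>2 + 2 * (cmod (g x))\<^sup>2)"
      using assms by (auto simp: square_integrable_def)
    show "AE x in halfline. norm ((cmod (f x + g x))\<^sup>2)
            \<le> norm (2 * (cmod (f x))\<^sup>2 + 2 * (cmod (g x))\<^sup>2)"
      using cmod_add_power2_le [of 1 "f _" "g _"] by auto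
  qed measurable
  then show ?thesis
    by (simp add: square_integrable_def)
qed

definition L2_eq :: "(real \<Rightarrow> complex) \<Rightarrow> (real \<Rightarrow> complex) \<Rightarrow> bool" where
  "L2_eq f g \<longleftrightarrow>
     square_integrable f \<and> square_integrable g \<and> (AE x in halfline. f x = g x)"

quotient_type L2 = "real \<Rightarrow> complex" / partial: L2_eq
  morphisms rep_L2 abs_L2
proof (rule part_equivpI)
  show "\<exists>f. L2_eq f f"
    using square_integrable_zero by (auto simp: L2_eq_def)
  show "symp L2_eq"
    by (auto simp: symp_def L2_eq_def)
  show "transp L2_eq"
    by (auto simp: transp_def L2_eq_def)
qed

instantiation L2 :: complex_normed_vector
begin

lift_definition zero_L2 :: L2 is "\<lambda>x. 0"
  by (simp add: L2_eq_def square_integrable_zero)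

lift_definition plus_L2 :: "L2 \<Rightarrow> L2 \<Rightarrow> L2" is "\<lambda>f g x. f x + g x"
  by (auto simp: L2_eq_def intro: square_integrable_add)

lift_definition scaleC_L2 :: "complex \<Rightarrow> L2 \<Rightarrow> L2" is "\<lambda>a f x. a * f x"
  by (auto simp: L2_eq_def intro: square_integrable_cmult)

lift_definition norm_L2 :: "L2 \<Rightarrow> real" is "\<lambda>f. sqrt (LINT x|halfline. (cmod (f x))\<^sup>2)"
proof -
  fix f g assume "L2_eq f g"
  then have "(LINT x|halfline. (cmod (f x))\<^sup>2) = (LINT x|halfline. (cmod (g x))\<^sup>2)"
    by (intro integral_cong_AE) (auto simp: L2_eq_def square_integrable_def)
  then show "sqrt (LINT x|halfline. (cmod (f x))\<^sup>2) = sqrt (LINT x|halfline. (cmod (g x))\<^sup>2)"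
    by simp
qed

definition scaleR_L2_def: "r *\<^sub>R (x :: L2) = complex_of_real r *\<^sub>C x"
definition uminus_L2_def: "- (x :: L2) = (- 1) *\<^sub>C x"
definition minus_L2_def: "x - y = x + - (y :: L2)"
definition sgn_L2_def: "sgn (x :: L2) = inverse (norm x) *\<^sub>R x"
definition dist_L2_def: "dist x (y :: L2) = norm (x - y)"
definition uniformity_L2_def:
  "(uniformity :: (L2 \<times> L2) filter) = (INF e\<in>{0<..}. principal {(x, y). dist x y < e})"
definition open_L2_def:
  "open (U :: L2 set) = (\<forall>x\<in>U. \<forall>\<^sub>F (x', y) in uniformity. x' = x \<longrightarrow> y \<in> U)"

instance
proof
  fix a b :: complex and r s :: real and x y z :: L2 and U :: "L2 set"
  show "x + y + z = x + (y + z)"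
    by transfer (auto simp: L2_eq_def add.assoc intro!: square_integrable_add)
  show "x + y = y + x"
    by transfer (auto simp: L2_eq_def add.commute intro!: square_integrable_add)
  show "0 + x = x"
    by transfer (auto simp: L2_eq_def)
  show "- x + x = 0"
    unfolding uminus_L2_def
    by transfer (auto simp: L2_eq_def square_integrable_zero)
  show "x - y = x + - y"
    by (simp add: minus_L2_def)
  have Cr: "a *\<^sub>C (x + y) = a *\<^sub>C x + a *\<^sub>C y" for a and x y :: L2
    by transfer (auto simp: L2_eq_def distrib_left
        intro!: square_integrable_add square_integrable_cmult)
  have Cl: "(a + b) *\<^sub>C x = a *\<^sub>C x + b *\<^sub>C x" for a b and x :: L2
    by transfer (auto simp: L2_eq_def distrib_right
        intro!: square_integrable_add square_integrable_cmult)
  have CC: "a *\<^sub>C b *\<^sub>C x = (a * b) *\<^sub>C x" for a b and x :: L2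
    by transfer (auto simp: L2_eq_def mult.assoc intro!: square_integrable_cmult)
  have nC: "norm (a *\<^sub>C x) = cmod a * norm x" for a and x :: L2
    by transfer (simp add: norm_mult power_mult_distrib real_sqrt_mult)
  show "a *\<^sub>C (x + y) = a *\<^sub>C x + a *\<^sub>C y"
    by (rule Cr)
  show "(a + b) *\<^sub>C x = a *\<^sub>C x + b *\<^sub>C x"
    by (rule Cl)
  show "a *\<^sub>C b *\<^sub>C x = (a * b) *\<^sub>C x"
    by (rule CC)
  show "norm (a *\<^sub>C x) = cmod a * norm x"
    by (rule nC)
  show "complex_of_real r *\<^sub>C x = r *\<^sub>R x"
    by (simp add: scaleR_L2_def)
  show "r *\<^sub>R (x + y) = r *\<^sub>R x + r *\<^sub>R y"
    by (simp add: scaleR_L2_def Cr)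
  show "(r + s) *\<^sub>R x = r *\<^sub>R x + s *\<^sub>R x"
    by (simp add: scaleR_L2_def Cl)
  show "r *\<^sub>R s *\<^sub>R x = (r * s) *\<^sub>R x"
    by (simp add: scaleR_L2_def CC)
  show "1 *\<^sub>R x = x"
    unfolding scaleR_L2_def by transfer (auto simp: L2_eq_def)
  show "norm (r *\<^sub>R x) = \<bar>r\<bar> * norm x"
    by (simp add: scaleR_L2_def nC)
  show "dist x y = norm (x - y)"
    by (simp add: dist_L2_def)
  show "sgn x = inverse (norm x) *\<^sub>R x"
    by (simp add: sgn_L2_def)
  show "uniformity = (INF e\<in>{0<..}. principal {(x, y :: L2). dist x y < e})"
    by (simp add: uniformity_L2_def)
  show "open U = (\<forall>x\<in>U. \<forall>\<^sub>F (x', y) in uniformity. x' = x \<longrightarrow> y \<in> U)"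
    by (simp add: open_L2_def)
  have n0: "norm x = 0 \<longleftrightarrow> x = 0" for x :: L2
  proof transfer
    fix f assume f: "L2_eq f f"
    then have "(LINT x|halfline. (cmod (f x))\<^sup>2) = 0 \<longleftrightarrow> (AE x in halfline. (cmod (f x))\<^sup>2 = 0)"
      by (intro integral_nonneg_eq_0_iff_AE) (auto simp: L2_eq_def square_integrable_def)
    with f show "sqrt (LINT x|halfline. (cmod (f x))\<^sup>2) = 0 \<longleftrightarrow> L2_eq f (\<lambda>x. 0)"
      by (auto simp: L2_eq_def square_integrable_zero)
  qed
  show "norm x = 0 \<longleftrightarrow> x = 0"
    by (rule n0)
  have nn: "0 \<le> norm x" for x :: L2
    by transfer simp
  have young: "(norm (x + y))\<^sup>2 \<le> (1 + t) * (norm x)\<^sup>2 + (1 + 1 / t) * (norm y)\<^sup>2"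
    if "0 < t" for t and x y :: L2
  using that proof (transfer fixing: t)
    fix f g assume t: "0 < t" and "L2_eq f f" "L2_eq g g"
    then have f: "square_integrable f" and g: "square_integrable g"
      by (auto simp: L2_eq_def)
    have fg: "integrable halfline (\<lambda>x. (cmod (f x + g x))\<^sup>2)"
      using square_integrable_add [OF f g] by (simp add: square_integrable_def)
    have "(LINT x|halfline. (cmod (f x + g x))\<^sup>2)
        \<le> (LINT x|halfline. (1 + t) * (cmod (f x))\<^sup>2 + (1 + 1 / t) * (cmod (g x))\<^sup>2)"
      using fg f g cmod_add_power2_le [OF t]
      by (intro integral_mono) (auto simp: square_integrable_def)
    also have "\<dots> = (1 + t) * (LINT x|halfline. (cmod (f x))\<^sup>2)
        + (1 + 1 / t) * (LINT x|halfline. (cmod (g x))\<^sup>2)"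
      using f g by (simp add: square_integrable_def)
    finally show "(sqrt (LINT x|halfline. (cmod (f x + g x))\<^sup>2))\<^sup>2
        \<le> (1 + t) * (sqrt (LINT x|halfline. (cmod (f x))\<^sup>2))\<^sup>2
          + (1 + 1 / t) * (sqrt (LINT x|halfline. (cmod (g x))\<^sup>2))\<^sup>2"
      by simp
  qed
  show "norm (x + y) \<le> norm x + norm y"
  proof (cases "x = 0 \<or> y = 0")
    case True
    have "0 + w = w" "w + 0 = w" for w :: L2
      by (transfer, auto simp: L2_eq_def)+
    with True nn show ?thesis
      by auto
  next
    case False
    then have pos: "0 < norm x" "0 < norm y"
      using n0 nn by (metis order_le_less)+
    have "(1 + norm y / norm x) * (norm x)\<^sup>2 + (1 + 1 / (norm y / norm x)) * (norm y)\<^sup>2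
        = (norm x + norm y)\<^sup>2"
      using pos by (simp add: distrib_right power2_eq_square) (simp add: algebra_simps)
    with young [of "norm y / norm x" x y] pos
    have "(norm (x + y))\<^sup>2 \<le> (norm x + norm y)\<^sup>2"
      by simp
    then show ?thesis
      using nn by (meson add_nonneg_nonneg power2_le_imp_le)
  qed
qed

end


section \<open>Sobolev spaces on the half-line\<close>

text \<open>The space $C_c^\infty((0,\infty))$, its elements being extended by zero to the real line;
  the functions \<open>D k\<close> are the successive derivatives.\<close>

definition test_function :: "(real \<Rightarrow> complex) \<Rightarrow> bool" where
  "test_function \<eta> \<longleftrightarrow>
     (\<exists>D :: nat \<Rightarrow> real \<Rightarrow> complex.
        D 0 = \<eta> \<and> (\<forall>k x. (D k has_vector_derivative D (Suc k) x) (at x))) \<and>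
     (\<exists>a b. 0 < a \<and> (\<forall>x. x \<notin> {a..b} \<longrightarrow> \<eta> x = 0))"

definition has_weak_deriv :: "L2 \<Rightarrow> L2 \<Rightarrow> bool" where
  "has_weak_deriv \<psi> \<phi> \<longleftrightarrow>
     (\<forall>\<eta>. test_function \<eta> \<longrightarrow>
        (LINT x|halfline. rep_L2 \<psi> x * vector_derivative \<eta> (at x)) =
        - (LINT x|halfline. rep_L2 \<phi> x * \<eta> x))"

definition weak_deriv :: "L2 \<Rightarrow> L2" where
  "weak_deriv \<psi> = (THE \<phi>. has_weak_deriv \<psi> \<phi>)"

definition H1 :: "L2 set" where
  "H1 = {\<psi>. \<exists>\<phi>. has_weak_deriv \<psi> \<phi>}"

definition H2 :: "L2 set" where
  "H2 = {\<psi> \<in> H1. weak_deriv \<psi> \<in> H1}"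

text \<open>The value \<open>\<psi>(0)\<close>, meaning that of the representative which is continuous on the closed
  half-line; such a representative exists for \<open>\<psi> \<in> H1\<close>.\<close>

definition value_at_0 :: "L2 \<Rightarrow> complex" where
  "value_at_0 \<psi> =
     (THE v. \<exists>g. continuous_on {0..} g \<and> (AE x in halfline. g x = rep_L2 \<psi> x) \<and> g 0 = v)"


section \<open>Unbounded operators\<close>

text \<open>\<open>op_apply A\<close> is a total function, but only its values on \<open>op_dom A\<close> matter.\<close>

datatype 'a unbounded_op = Op (op_dom: "'a set") (op_apply: "'a \<Rightarrow> 'a")

definition minus_scalar ::
    "'a::complex_normed_vector unbounded_op \<Rightarrow> complex \<Rightarrow> 'a unbounded_op" where
  "minus_scalar A w = Op (op_dom A) (\<lambda>x. op_apply A x - w *\<^sub>C x)"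

definition resolvent ::
    "'a::complex_normed_vector unbounded_op \<Rightarrow> complex \<Rightarrow> 'a \<Rightarrow> 'a" where
  "resolvent A z = inv_into (op_dom A) (op_apply (minus_scalar A z))"

text \<open>Complex linearity of the inverse follows from that of \<open>A\<close>, so requiring it to be a bounded
  real linear map is the usual condition.\<close>

definition resolvent_set :: "'a::complex_normed_vector unbounded_op \<Rightarrow> complex set" where
  "resolvent_set A =
     {z. bij_betw (op_apply (minus_scalar A z)) (op_dom A) UNIV \<and> bounded_linear (resolvent A z)}"


section \<open>The Dirac operator and the Robin Laplacian\<close>

text \<open>$L^2((0,\infty),\mathbb{C}^2)$ is \<open>L2 \<times> L2\<close>, whose norm is
  \<open>sqrt ((norm \<psi>\<^sub>1)\<^sup>2 + (norm \<psi>\<^sub>2)\<^sup>2)\<close>.\<close>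

definition dirac_op :: "real \<Rightarrow> real \<Rightarrow> real \<Rightarrow> (L2 \<times> L2) unbounded_op" where
  "dirac_op m \<alpha> c = Op
     {(\<psi>\<^sub>1, \<psi>\<^sub>2). \<psi>\<^sub>1 \<in> H1 \<and> \<psi>\<^sub>2 \<in> H1 \<and>
        value_at_0 \<psi>\<^sub>1 * complex_of_real (cot \<alpha> / (m * c)) = value_at_0 \<psi>\<^sub>2}
     (\<lambda>(\<psi>\<^sub>1, \<psi>\<^sub>2).
        ((m * c\<^sup>2) *\<^sub>R \<psi>\<^sub>1 - c *\<^sub>R weak_deriv \<psi>\<^sub>2,
         c *\<^sub>R weak_deriv \<psi>\<^sub>1 - (m * c\<^sup>2) *\<^sub>R \<psi>\<^sub>2))"

definition robin_laplacian :: "real \<Rightarrow> real \<Rightarrow> L2 unbounded_op" where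
  "robin_laplacian m \<beta> = Op
     {\<psi> \<in> H2. value_at_0 (weak_deriv \<psi>) = complex_of_real \<beta> * value_at_0 \<psi>}
     (\<lambda>\<psi>. - ((1 / (2 * m)) *\<^sub>R weak_deriv (weak_deriv \<psi>)))"

end

theory Submission
  imports Defs
begin

text \<open>
  Write $u = \psi_1$, $v = 2mc\,\psi_2$ and $\varepsilon = z/(2mc^2)$. After this rescaling the
  equation $(D_{0,c} - mc^2 - z)\psi = (f, g)$ with its boundary condition becomes the system
  $$-v'/(2m) - z u = f, \qquad u' - v = g/c + \varepsilon v, \qquad v(0) = 2\cot(\alpha)\,u(0)$$
  (lemma \<open>dirac_iff_robin_system\<close>). The left-hand sides and the boundary condition do not depend
  on $c$, and for right-hand side $(f, 0)$ the system says $v = u'$ and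
  $-u''/(2m) - zu = f$, $u'(0) = 2\cot(\alpha)\,u(0)$, that is, $u = (S_0 - z)^{-1} f$. So the
  nonrelativistic limit is the perturbation $(0, g/c + \varepsilon v)$ of the data, which is small
  in norm: if the system has a bounded solution operator $W$, then
  $w = W((f, g/c) + \varepsilon P w)$ with $P(u, v) = (0, v)$ has a unique solution by Banach's
  fixed point theorem as soon as $\|W\|\,|\varepsilon| \le 1/2$, and
  $w - W(f, 0) = O(1/c)\,(\|f\| + \|g\|)$ (lemmas \<open>fixed_point_of_small_perturbation\<close> and
  \<open>dirac_resolvent_estimate\<close>).

  The operator $W$ exists for every $z \in \rho(S_0)$ (lemma
  \<open>robin_system_solution_operator\<close>). At the special point $z_0 = -1/(2m)$ the functions $p = u + v$
  and $q = u - v$ satisfy the decoupled equations $p' = p + \dots$ and $q' = -q + \dots$, which are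
  solved by exponential kernels bounded on $L^2$. The solution at $z_0$ solves the system at $z$ up
  to the error $(z - z_0)u$ in the first component only, and this is removed with
  $(S_0 - z)^{-1}$.

  What remains is the calculus of the weak derivative. An $L^2$ function is in $H^1$
  exactly if it is almost everywhere $c + \int_0^x \varphi$ with $\varphi \in L^2$; then $\varphi$ is
  its weak derivative and $c$ its boundary value (lemma \<open>primitive_of_iff\<close>). This rests on the
  lemma of du Bois-Reymond, hence on the existence of smooth bump functions. The fixed point
  argument needs that $L^2$ is complete.
\<close>

section \<open>Integration on the half-line and the product rule\<close>

lemma space_halfline [simp]: "space halfline = {0<..}"
  by (simp add: halfline_def space_restrict_space)

lemma measurable_halfline:
  assumes "f \<in> borel_measurable borel"
  shows "f \<in> borel_measurable halfline"
  using assms unfolding halfline_def by (simp add: measurable_restrict_space1)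

lemma measurable_halfline_id [measurable]: "(\<lambda>x. x) \<in> borel_measurable halfline"
  by (rule measurable_halfline) simp

lemma measurable_halfline_cont:
  assumes "continuous_on UNIV f" shows "f \<in> borel_measurable halfline"
  by (intro measurable_halfline borel_measurable_continuous_onI assms)

interpretation halfline: sigma_finite_measure halfline
  unfolding halfline_def by (rule sigma_finite_measure_restrict_space) (auto simp: lborel.sigma_finite_measure_axioms)

interpretation halfline_pair: pair_sigma_finite halfline halfline ..

lemma AE_halfline: "(AE x in halfline. P x) \<longleftrightarrow> (AE x in lborel. 0 < x \<longrightarrow> P x)"
  unfolding halfline_def by (subst AE_restrict_space_iff) auto

lemma AE_halfline_neq: "AE x in halfline. x \<noteq> a"
  using AE_lborel_singleton[of a] by (auto simp: AE_halfline)

lemma integrable_halfline: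
  fixes f :: "real \<Rightarrow> 'a::{banach,second_countable_topology}"
  shows "integrable halfline f \<longleftrightarrow> integrable lborel (\<lambda>x. indicator {0<..} x *\<^sub>R f x)"
  unfolding halfline_def by (subst integrable_restrict_space) auto

lemma integral_halfline:
  fixes f :: "real \<Rightarrow> 'a::{banach,second_countable_topology}"
  shows "(LINT x|halfline. f x) = (LINT x|lborel. indicator {0<..} x *\<^sub>R f x)"
  unfolding halfline_def by (subst integral_restrict_space) auto

definition loc_integrable :: "(real \<Rightarrow> complex) \<Rightarrow> bool" where
  "loc_integrable f \<longleftrightarrow> f \<in> borel_measurable halfline \<and>
     (\<forall>N. integrable halfline (\<lambda>x. indicator {..N} x * f x))"

text \<open>The measure \<open>halfline\<close> lives on the positive reals, so the integral over \<open>{..x}\<close> is the integral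
  over $(0, x]$.\<close>

definition integral_from_0 :: "(real \<Rightarrow> complex) \<Rightarrow> real \<Rightarrow> complex" where
  "integral_from_0 f x = (LINT t|halfline. indicator {..x} t * f t)"

lemma loc_integrableD:
  assumes "loc_integrable f"
  shows "f \<in> borel_measurable halfline" "integrable halfline (\<lambda>x. indicator {..N} x * f x)"
  using assms by (auto simp: loc_integrable_def)

lemma loc_integrable_add:
  assumes "loc_integrable f" "loc_integrable g"
  shows "loc_integrable (\<lambda>x. f x + g x)"
  using assms by (auto simp: loc_integrable_def distrib_left)

lemma loc_integrable_cmult:
  assumes "loc_integrable f"
  shows "loc_integrable (\<lambda>x. a * f x)"
  using assms by (auto simp: loc_integrable_def mult.left_commute[of _ a])

lemma loc_integrable_diff:
  assumes "loc_integrable f" "loc_integrable g"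
  shows "loc_integrable (\<lambda>x. f x - g x)"
  using assms by (auto simp: loc_integrable_def right_diff_distrib)

lemma integral_from_0_add:
  assumes "loc_integrable f" "loc_integrable g"
  shows "integral_from_0 (\<lambda>x. f x + g x) x = integral_from_0 f x + integral_from_0 g x"
  using assms by (simp add: integral_from_0_def loc_integrable_def distrib_left)

lemma integral_from_0_cmult: "integral_from_0 (\<lambda>x. a * f x) x = a * integral_from_0 f x"
  by (simp add: integral_from_0_def mult.left_commute[of _ a])

lemma integral_from_0_diff:
  assumes "loc_integrable f" "loc_integrable g"
  shows "integral_from_0 (\<lambda>x. f x - g x) x = integral_from_0 f x - integral_from_0 g x"
  using assms by (simp add: integral_from_0_def loc_integrable_def right_diff_distrib)

lemma integral_from_0_nonpos: "x \<le> 0 \<Longrightarrow> integral_from_0 f x = 0"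
  unfolding integral_from_0_def
  by (subst Bochner_Integration.integral_cong[where g = "\<lambda>_. 0", OF refl]) (auto simp: indicator_def)

lemma integral_from_0_cong: "(\<And>t. 0 < t \<Longrightarrow> f t = g t) \<Longrightarrow> integral_from_0 f x = integral_from_0 g x"
  unfolding integral_from_0_def by (intro Bochner_Integration.integral_cong refl) simp

lemma integral_from_0_cong_AE:
  assumes "f \<in> borel_measurable halfline" "g \<in> borel_measurable halfline" "AE x in halfline. f x = g x"
  shows "integral_from_0 f x = integral_from_0 g x"
  unfolding integral_from_0_def using assms by (intro integral_cong_AE) auto

lemma integrable_indicator_halfline:
  "integrable halfline (indicator {..N} :: real \<Rightarrow> real)"
proof -
  have "integrable lborel (indicator {0<..N} :: real \<Rightarrow> real)"
    by (cases "0 \<le> N") (simp_all add: integrable_indicator_iff)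
  moreover have "(\<lambda>x. indicator {0<..} x *\<^sub>R (indicator {..N} x :: real)) = indicator {0<..N}"
    by (auto simp: indicator_def fun_eq_iff)
  ultimately show ?thesis by (simp add: integrable_halfline)
qed

lemma loc_integrable_bounded_mult:
  assumes f: "loc_integrable f" and g [measurable]: "g \<in> borel_measurable halfline"
    and b: "\<And>N. \<exists>B. \<forall>x. 0 < x \<and> x \<le> N \<longrightarrow> cmod (g x) \<le> B"
  shows "loc_integrable (\<lambda>x. g x * f x)"
  unfolding loc_integrable_def
proof (intro conjI allI)
  note [measurable] = loc_integrableD(1)[OF f]
  show "(\<lambda>x. g x * f x) \<in> borel_measurable halfline" by measurable
  fix N
  obtain B where B: "\<And>x. 0 < x \<and> x \<le> N \<Longrightarrow> cmod (g x) \<le> B" using b by blast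
  show "integrable halfline (\<lambda>x. indicator {..N} x * (g x * f x))"
  proof (rule Bochner_Integration.integrable_bound)
    show "integrable halfline (\<lambda>x. B * cmod (indicator {..N} x * f x))"
      using loc_integrableD(2)[OF f] by simp
    show "AE x in halfline. norm (indicator {..N} x * (g x * f x)) \<le> norm (B * cmod (indicator {..N} x * f x))"
      by (rule AE_I2) (auto simp: indicator_def norm_mult abs_mult intro!: mult_right_mono order_trans[OF B abs_ge_self])
  qed measurable
qed

lemma bounded_on_Ioc:
  assumes "continuous_on {0..} (g::real\<Rightarrow>complex)"
  shows "\<exists>B. \<forall>x. 0 < x \<and> x \<le> N \<longrightarrow> cmod (g x) \<le> B"
proof -
  have "compact (g ` {0..N})"
    by (intro compact_continuous_image continuous_on_subset[OF assms]) auto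
  then obtain B where "\<forall>y\<in>g ` {0..N}. norm y \<le> B"
    using compact_imp_bounded bounded_iff by blast
  then show ?thesis by (intro exI[of _ B]) auto
qed

lemma le_one_plus_square: "y \<le> 1 + y\<^sup>2" for y :: real
  using self_le_power[of y 2] by (cases "1 \<le> y") (auto intro: add_increasing2)

lemma loc_integrable_square_integrable:
  assumes "square_integrable f" shows "loc_integrable f"
  unfolding loc_integrable_def
proof (intro conjI allI)
  show [measurable]: "f \<in> borel_measurable halfline" using assms by (simp add: square_integrable_def)
  fix N
  show "integrable halfline (\<lambda>x. indicator {..N} x * f x)"
  proof (rule Bochner_Integration.integrable_bound)
    show "integrable halfline (\<lambda>x. indicator {..N} x + (cmod (f x))\<^sup>2)"
      using assms integrable_indicator_halfline by (auto simp: square_integrable_def)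
    show "AE x in halfline. norm (indicator {..N} x * f x) \<le> norm (indicator {..N} x + (cmod (f x))\<^sup>2)"
      using le_one_plus_square by (intro AE_I2) (auto simp: indicator_def norm_mult)
  qed measurable
qed

lemma loc_integrable_one: "loc_integrable (\<lambda>x. 1)"
proof -
  have "(\<lambda>x. indicator {..N} x :: complex) = (\<lambda>x. of_real (indicator {..N} x))" for N :: real
    by (auto simp: indicator_def)
  then show ?thesis
    using integrable_indicator_halfline by (simp add: loc_integrable_def)
qed

lemma loc_integrable_cont:
  assumes "continuous_on UNIV g"
  shows "loc_integrable g"
  using loc_integrable_bounded_mult[OF loc_integrable_one measurable_halfline_cont[OF assms]
     bounded_on_Ioc[OF continuous_on_subset[OF assms subset_UNIV]]] by simp

lemma loc_integrable_mult_continuous: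
  assumes "loc_integrable f" "continuous_on UNIV g"
  shows "loc_integrable (\<lambda>x. g x * f x)"
  by (intro loc_integrable_bounded_mult assms measurable_halfline_cont bounded_on_Ioc continuous_on_subset[OF assms(2)]) auto

text \<open>Dominated convergence: the indicators of \<open>{..u n}\<close> converge off the null set \<open>{x}\<close>.\<close>

lemma continuous_integral_from_0:
  assumes f: "loc_integrable f"
  shows "continuous_on UNIV (integral_from_0 f)"
  unfolding continuous_on_eq_continuous_at[OF open_UNIV]
proof (intro ballI, unfold continuous_at_sequentially o_def, intro allI impI)
  note [measurable] = loc_integrableD(1)[OF f]
  fix x :: real and u assume u: "u \<longlonglongrightarrow> x"
  obtain B where B: "\<And>n. \<bar>u n\<bar> \<le> B"
    using convergent_imp_Bseq[OF convergentI[OF u]] by (auto simp: Bseq_def)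
  show "(\<lambda>n. integral_from_0 f (u n)) \<longlonglongrightarrow> integral_from_0 f x"
    unfolding integral_from_0_def
  proof (rule integral_dominated_convergence)
    show "integrable halfline (\<lambda>t. cmod (indicator {..B} t * f t))"
      using loc_integrableD(2)[OF f] by (rule integrable_norm)
    show "AE t in halfline. norm (indicator {..u n} t * f t) \<le> cmod (indicator {..B} t * f t)" for n
      using B[of n] by (intro AE_I2) (auto simp: indicator_def)
    show "AE t in halfline. (\<lambda>n. indicator {..u n} t * f t) \<longlonglongrightarrow> indicator {..x} t * f t"
      using AE_halfline_neq[of x]
    proof eventually_elim
      case (elim t)
      have "\<forall>\<^sub>F n in sequentially. (indicator {..u n} t :: complex) = indicator {..x} t"
      proof (cases "t < x")
        case True
        from order_tendstoD(1)[OF u True] show ?thesis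
          by eventually_elim (use True in \<open>auto simp: indicator_def\<close>)
      next
        case False
        then have "x < t" using elim by simp
        from order_tendstoD(2)[OF u this] show ?thesis
          by eventually_elim (use \<open>x < t\<close> in \<open>auto simp: indicator_def\<close>)
      qed
      then show ?case
        by (intro tendsto_mult tendsto_const) (auto intro: tendsto_eventually)
    qed
  qed measurable
qed

text \<open>Both sides integrate $f(s)g(t)$ over the square $(0,x]^2$: the two summands on the right are the
  integrals over the triangles $t \le s$ and $s \le t$, which overlap in the diagonal only. Fubini turns
  the first triangle into an iterated integral in the other order.\<close>

lemma integral_from_0_mult:
  assumes f: "loc_integrable f" and g: "loc_integrable g"
  shows "integral_from_0 f x * integral_from_0 g x = integral_from_0 (\<lambda>t. f t * integral_from_0 g t + integral_from_0 f t * g t) x"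
proof -
  note [measurable] = loc_integrableD(1)[OF f] loc_integrableD(1)[OF g]
  have cf: "continuous_on UNIV (integral_from_0 f)" and cg: "continuous_on UNIV (integral_from_0 g)"
    using continuous_integral_from_0 f g by auto
  have lf: "loc_integrable (\<lambda>t. integral_from_0 g t * f t)"
    by (intro loc_integrable_mult_continuous f continuous_integral_from_0 g)
  have lg: "loc_integrable (\<lambda>t. integral_from_0 f t * g t)"
    by (intro loc_integrable_mult_continuous g continuous_integral_from_0 f)
  define h where "h = (\<lambda>s t. (indicator {..x} s * f s) * (indicator {..x} t * g t) * (indicator {..s} t))"
  have m [measurable]: "(\<lambda>(s,t). h s t) \<in> borel_measurable (halfline \<Otimes>\<^sub>M halfline)"
    unfolding h_def indicator_def by simp
  have i1: "integrable (halfline \<Otimes>\<^sub>M halfline) (\<lambda>p. (indicator {..x} (fst p) * f (fst p)) * (indicator {..x} (snd p) * g (snd p)))"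
  proof (rule halfline_pair.Fubini_integrable)
    show "integrable halfline (\<lambda>s. LINT t|halfline. norm ((indicator {..x} (fst (s,t)) * f (fst (s,t))) * (indicator {..x} (snd (s,t)) * g (snd (s,t)))))"
      using loc_integrableD(2)[OF f, of x, THEN integrable_norm] by (simp add: norm_mult)
    show "AE s in halfline. integrable halfline (\<lambda>t. (indicator {..x} (fst (s,t)) * f (fst (s,t))) * (indicator {..x} (snd (s,t)) * g (snd (s,t))))"
      using loc_integrableD(2)[OF g, of x] by simp
  qed measurable
  have "integrable (halfline \<Otimes>\<^sub>M halfline) (\<lambda>(s,t). h s t)"
    by (rule Bochner_Integration.integrable_bound[OF i1]) (auto simp: h_def indicator_def)
  then have Fub: "(LINT t|halfline. (LINT s|halfline. h s t)) = (LINT s|halfline. (LINT t|halfline. h s t))"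
    by (rule halfline_pair.Fubini_integral)
  have "(LINT t|halfline. h s t) = indicator {..x} s * (integral_from_0 g s * f s)" for s
  proof -
    have "(LINT t|halfline. h s t) = (LINT t|halfline. (indicator {..x} s * f s) * (indicator {..s} t * g t))"
      by (intro Bochner_Integration.integral_cong refl) (auto simp: h_def indicator_def)
    then show ?thesis by (simp add: integral_from_0_def)
  qed
  then have 1: "(LINT s|halfline. (LINT t|halfline. h s t)) = integral_from_0 (\<lambda>t. integral_from_0 g t * f t) x"
    by (simp add: integral_from_0_def[of _ x])
  have "(LINT s|halfline. h s t) = indicator {..x} t * ((integral_from_0 f x - integral_from_0 f t) * g t)" for t
  proof -
    \<comment> \<open>The two integrands differ at $s = t$ only.\<close>
    have "(LINT s|halfline. h s t) = (LINT s|halfline. (indicator {..x} t * g t) * (indicator {..x} s * f s - indicator {..t} s * f s))"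
    proof (rule integral_cong_AE)
      show "AE s in halfline. h s t = (indicator {..x} t * g t) * (indicator {..x} s * f s - indicator {..t} s * f s)"
        using AE_halfline_neq[of t] by eventually_elim (auto simp: h_def indicator_def)
    qed (auto simp: h_def indicator_def[abs_def])
    then show ?thesis using loc_integrableD(2)[OF f] by (simp add: integral_from_0_def)
  qed
  then have 2: "(LINT t|halfline. (LINT s|halfline. h s t)) = integral_from_0 (\<lambda>t. (integral_from_0 f x - integral_from_0 f t) * g t) x"
    by (simp add: integral_from_0_def[of _ x])
  have "integral_from_0 (\<lambda>t. (integral_from_0 f x - integral_from_0 f t) * g t) x = integral_from_0 f x * integral_from_0 g x - integral_from_0 (\<lambda>t. integral_from_0 f t * g t) x"
    using g lg by (simp add: left_diff_distrib integral_from_0_diff loc_integrable_cmult integral_from_0_cmult)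
  with 1 2 Fub have "integral_from_0 f x * integral_from_0 g x = integral_from_0 (\<lambda>t. integral_from_0 g t * f t) x + integral_from_0 (\<lambda>t. integral_from_0 f t * g t) x"
    by (simp add: algebra_simps)
  also have "\<dots> = integral_from_0 (\<lambda>t. f t * integral_from_0 g t + integral_from_0 f t * g t) x"
    using integral_from_0_add[OF lf lg] by (simp add: mult.commute)
  finally show ?thesis .
qed

text \<open>Functions of the form $c + \int_0^x f$ are exactly the locally absolutely continuous ones; this is
  integration by parts for them, and it replaces pointwise differentiation below.\<close>

lemma product_rule:
  assumes f: "loc_integrable f" and g: "loc_integrable g"
    and F: "\<And>x. 0 < x \<Longrightarrow> F x = a + integral_from_0 f x" and G: "\<And>x. 0 < x \<Longrightarrow> G x = b + integral_from_0 g x"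
    and x: "0 < x"
  shows "F x * G x = a * b + integral_from_0 (\<lambda>t. f t * G t + F t * g t) x"
proof -
  have cf: "continuous_on UNIV (integral_from_0 f)" and cg: "continuous_on UNIV (integral_from_0 g)"
    using continuous_integral_from_0 f g by auto
  have lf: "loc_integrable (\<lambda>t. integral_from_0 g t * f t)"
    by (intro loc_integrable_mult_continuous f continuous_integral_from_0 g)
  have lg: "loc_integrable (\<lambda>t. integral_from_0 f t * g t)"
    by (intro loc_integrable_mult_continuous g continuous_integral_from_0 f)
  have "integral_from_0 (\<lambda>t. f t * G t + F t * g t) x = integral_from_0 (\<lambda>t. (b * f t + a * g t) + (integral_from_0 g t * f t + integral_from_0 f t * g t)) x"
    by (intro integral_from_0_cong) (simp add: F G ring_distribs mult_ac add_ac)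
  also have "\<dots> = b * integral_from_0 f x + a * integral_from_0 g x + integral_from_0 (\<lambda>t. integral_from_0 g t * f t + integral_from_0 f t * g t) x"
    using f g lf lg by (simp add: integral_from_0_add loc_integrable_add loc_integrable_cmult integral_from_0_cmult)
  also have "integral_from_0 (\<lambda>t. integral_from_0 g t * f t + integral_from_0 f t * g t) x = integral_from_0 f x * integral_from_0 g x"
    using integral_from_0_mult[OF f g] by (simp add: mult.commute)
  finally show ?thesis by (simp add: F[OF x] G[OF x] algebra_simps)
qed

lemma integral_from_0_of_derivative:
  assumes d: "\<And>x. (F has_vector_derivative f x) (at x)" and c: "continuous_on UNIV f" and x: "0 \<le> x"
  shows "F x = F 0 + integral_from_0 f x"
proof -
  have "(LINT t|lborel. indicator {0..x} t *\<^sub>R f t) = F x - F 0"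
    by (rule integral_FTC_atLeastAtMost[OF x])
      (use d c in \<open>auto intro: has_vector_derivative_at_within continuous_on_subset\<close>)
  moreover have "integral_from_0 f x = (LINT t|lborel. indicator {0..x} t *\<^sub>R f t)"
    unfolding integral_from_0_def integral_halfline
  proof (rule integral_cong_AE)
    have [measurable]: "f \<in> borel_measurable borel" using c by (rule borel_measurable_continuous_onI)
    show "AE t in lborel. indicator {0<..} t *\<^sub>R (indicator {..x} t * f t) = indicator {0..x} t *\<^sub>R f t"
      using AE_lborel_singleton[of 0] by eventually_elim (auto simp: indicator_def)
    show "(\<lambda>t. indicator {0<..} t *\<^sub>R (indicator {..x} t * f t)) \<in> borel_measurable lborel"
      "(\<lambda>t. indicator {0..x} t *\<^sub>R f t) \<in> borel_measurable lborel" by simp_all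
  qed
  ultimately show ?thesis by simp
qed


section \<open>Smooth bump functions\<close>

definition smooth :: "(real \<Rightarrow> complex) \<Rightarrow> bool" where
  "smooth g \<longleftrightarrow> (\<exists>D :: nat \<Rightarrow> real \<Rightarrow> complex.
        D 0 = g \<and> (\<forall>k x. (D k has_vector_derivative D (Suc k) x) (at x)))"

lemma test_function_iff:
  "test_function \<eta> \<longleftrightarrow> smooth \<eta> \<and> (\<exists>a b. 0 < a \<and> (\<forall>x. x \<notin> {a..b} \<longrightarrow> \<eta> x = 0))"
  by (simp add: test_function_def smooth_def)

text \<open>Iterating a choice of derivatives inside \<open>S\<close> yields the whole sequence of derivatives, so smoothness
  can be shown without formulas for the higher derivatives.\<close>

lemma smooth_by_closure:
  assumes "g \<in> S" and S: "\<And>f. f \<in> S \<Longrightarrow> \<exists>f'\<in>S. \<forall>x. (f has_vector_derivative f' x) (at x)"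
  shows "smooth g"
proof -
  from S obtain d where d: "\<And>f. f \<in> S \<Longrightarrow> d f \<in> S" "\<And>f x. f \<in> S \<Longrightarrow> (f has_vector_derivative d f x) (at x)"
    by metis
  have "(d ^^ k) g \<in> S" for k by (induction k) (auto simp: assms(1) d(1))
  then show ?thesis unfolding smooth_def by (intro exI[of _ "\<lambda>k. (d ^^ k) g"]) (auto intro: d(2))
qed

lemma smooth_derivative:
  assumes "smooth g"
  obtains g' where "smooth g'" "\<And>x. (g has_vector_derivative g' x) (at x)"
proof -
  from assms obtain D where D: "D 0 = g" "\<And>k x. (D k has_vector_derivative D (Suc k) x) (at x)"
    unfolding smooth_def by blast
  have "smooth (D 1)" unfolding smooth_def by (rule exI[of _ "\<lambda>k. D (Suc k)"]) (simp add: D(2))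
  with that[of "D 1"] D show ?thesis by force
qed

lemma smooth_antiderivative:
  assumes "smooth g'" and d: "\<And>x. (g has_vector_derivative g' x) (at x)"
  shows "smooth g"
proof -
  from assms obtain D where D: "D 0 = g'" "\<And>k x. (D k has_vector_derivative D (Suc k) x) (at x)"
    unfolding smooth_def by blast
  show ?thesis unfolding smooth_def
  proof (intro exI[of _ "\<lambda>k. case k of 0 \<Rightarrow> g | Suc j \<Rightarrow> D j"] conjI allI)
    fix k x show "((case k of 0 \<Rightarrow> g | Suc j \<Rightarrow> D j) has_vector_derivative (case Suc k of 0 \<Rightarrow> g | Suc j \<Rightarrow> D j) x) (at x)"
      using D d by (cases k) auto
  qed simp
qed

lemma smooth_continuous: assumes "smooth g" shows "continuous_on UNIV g"
proof -
  from assms obtain g' where "\<And>x. (g has_vector_derivative g' x) (at x)" using smooth_derivative by blast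
  then have "isCont g x" for x by (rule has_vector_derivative_continuous)
  then show ?thesis by (simp add: continuous_on_eq_continuous_at)
qed

lemma smooth_lincomb:
  assumes "smooth f" "smooth g"
  shows "smooth (\<lambda>x. a * f x + b * g x)"
proof (rule smooth_by_closure[where S = "{\<lambda>x. a * f x + b * g x | f g. smooth f \<and> smooth g}"])
  fix h assume "h \<in> {\<lambda>x. a * f x + b * g x | f g. smooth f \<and> smooth g}"
  then obtain f g where h: "h = (\<lambda>x. a * f x + b * g x)" and "smooth f" "smooth g" by blast
  then obtain f' g' where "smooth f'" "\<And>x. (f has_vector_derivative f' x) (at x)"
    "smooth g'" "\<And>x. (g has_vector_derivative g' x) (at x)"
    using smooth_derivative by metis
  then show "\<exists>f'\<in>{\<lambda>x. a * f x + b * g x | f g. smooth f \<and> smooth g}. \<forall>x. (h has_vector_derivative f' x) (at x)"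
    unfolding h by (intro bexI[of _ "\<lambda>x. a * f' x + b * g' x"]) (auto intro!: derivative_eq_intros)
qed (use assms in auto)

text \<open>The functions $e^{-1/t} t^{-k}$, extended by zero. The family over all \<open>k\<close> is closed
  under differentiation up to linear combinations, also at $t = 0$.\<close>

definition flat_exp :: "nat \<Rightarrow> real \<Rightarrow> real" where
  "flat_exp k t = (if 0 < t then exp (- (1 / t)) / t ^ k else 0)"

lemma flat_exp_tendsto_0: "(flat_exp k \<longlongrightarrow> 0) (at 0)"
proof -
  have "(flat_exp k \<longlongrightarrow> 0) (at_right 0)"
  proof (rule Lim_transform_eventually)
    have "((\<lambda>u::real. u ^ k / exp u) \<longlongrightarrow> 0) at_top" by (rule tendsto_power_div_exp_0)
    then have "((\<lambda>t::real. (inverse t) ^ k / exp (inverse t)) \<longlongrightarrow> 0) (at_right 0)"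
      by (rule filterlim_compose) (rule filterlim_inverse_at_top_right)
    then show "((\<lambda>t::real. (inverse t) ^ k / exp (inverse t)) \<longlongrightarrow> 0) (at_right 0)" .
    show "\<forall>\<^sub>F t in at_right 0. inverse t ^ k / exp (inverse t) = flat_exp k t"
      unfolding eventually_at_right_field
      by (intro exI[of _ 1]) (auto simp: flat_exp_def field_simps exp_minus)
  qed
  moreover have "(flat_exp k \<longlongrightarrow> 0) (at_left 0)"
    by (rule tendsto_eventually) (auto simp: eventually_at_left_field flat_exp_def intro!: exI[of _ "-1"])
  ultimately show ?thesis by (simp add: filterlim_split_at)
qed

lemma flat_exp_deriv: "(flat_exp k has_real_derivative flat_exp (k + 2) t - real k * flat_exp (k + 1) t) (at t)"
proof -
  consider "t < 0" | "t = 0" | "0 < t" by linarith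
  then show ?thesis
  proof cases
    case 1
    have "((\<lambda>_. 0) has_real_derivative 0) (at t)" by simp
    then have "(flat_exp k has_real_derivative 0) (at t)"
      by (rule has_field_derivative_transform_within_open[where S = "{..<0}"]) (use 1 in \<open>auto simp: flat_exp_def\<close>)
    then show ?thesis using 1 by (simp add: flat_exp_def)
  next
    case 2
    have "(\<lambda>h. (flat_exp k (0 + h) - flat_exp k 0) / h) = flat_exp (k + 1)"
      by (auto simp: flat_exp_def fun_eq_iff)
    then have "(flat_exp k has_real_derivative 0) (at 0)"
      using flat_exp_tendsto_0[of "k + 1"] by (simp add: DERIV_def)
    then show ?thesis using 2 by (simp add: flat_exp_def)
  next
    case 3
    have pk: "((\<lambda>t. t ^ k) has_real_derivative real k * t ^ k / t) (at t)"
      using 3 DERIV_pow[of k t] by (cases k) auto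
    have e: "((\<lambda>t. exp (- (1 / t))) has_real_derivative exp (- (1 / t)) / t\<^sup>2) (at t)"
      using 3 by (auto intro!: derivative_eq_intros simp: power2_eq_square)
    have "((\<lambda>t. exp (- (1 / t)) / t ^ k) has_real_derivative flat_exp (k + 2) t - real k * flat_exp (k + 1) t) (at t)"
      by (rule DERIV_cong[OF DERIV_divide[OF e pk]])
        (use 3 in \<open>auto simp: flat_exp_def field_simps power2_eq_square\<close>)
    then show ?thesis
      by (rule has_field_derivative_transform_within_open[where S = "{0<..}"]) (use 3 in \<open>auto simp: flat_exp_def\<close>)
  qed
qed

text \<open>The algebra generated by the functions \<open>flat_exp k\<close> after affine changes of variable.
  It is closed under differentiation, hence consists of smooth functions.\<close>

inductive_set bump_algebra :: "(real \<Rightarrow> real) set" where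
  base: "(\<lambda>x. flat_exp k (p * x + q)) \<in> bump_algebra"
| cmult: "f \<in> bump_algebra \<Longrightarrow> (\<lambda>x. c * f x) \<in> bump_algebra"
| add: "f \<in> bump_algebra \<Longrightarrow> g \<in> bump_algebra \<Longrightarrow> (\<lambda>x. f x + g x) \<in> bump_algebra"
| mult: "f \<in> bump_algebra \<Longrightarrow> g \<in> bump_algebra \<Longrightarrow> (\<lambda>x. f x * g x) \<in> bump_algebra"

lemma bump_algebra_deriv:
  assumes "f \<in> bump_algebra" shows "\<exists>f'\<in>bump_algebra. \<forall>x. (f has_real_derivative f' x) (at x)"
  using assms
proof induction
  case (base k p q)
  have "((\<lambda>x. flat_exp k (p * x + q)) has_real_derivative
     p * flat_exp (k + 2) (p * x + q) + (- p * real k) * flat_exp (k + 1) (p * x + q)) (at x)" for x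
    by (rule DERIV_cong[OF DERIV_chain2[where f = "flat_exp k" and g = "\<lambda>x. p * x + q" and Db = p, OF flat_exp_deriv]])
      (auto intro!: derivative_eq_intros simp: algebra_simps)
  then show ?case
    by (intro bexI[of _ "\<lambda>x. p * flat_exp (k + 2) (p * x + q) + (- p * real k) * flat_exp (k + 1) (p * x + q)"]
       bump_algebra.intros allI)
next
  case (cmult f c)
  then obtain f' where "f'\<in>bump_algebra" "\<forall>x. (f has_real_derivative f' x) (at x)" by blast
  then show ?case by (intro bexI[of _ "\<lambda>x. c * f' x"]) (auto intro!: derivative_eq_intros bump_algebra.intros)
next
  case (add f g)
  then obtain f' g' where "f'\<in>bump_algebra" "\<forall>x. (f has_real_derivative f' x) (at x)"
     "g'\<in>bump_algebra" "\<forall>x. (g has_real_derivative g' x) (at x)" by blast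
  then show ?case by (intro bexI[of _ "\<lambda>x. f' x + g' x"]) (auto intro!: derivative_eq_intros bump_algebra.intros)
next
  case (mult f g)
  then obtain f' g' where "f'\<in>bump_algebra" "\<forall>x. (f has_real_derivative f' x) (at x)"
     "g'\<in>bump_algebra" "\<forall>x. (g has_real_derivative g' x) (at x)" by blast
  with mult show ?case
    by (intro bexI[of _ "\<lambda>x. f' x * g x + f x * g' x"]) (auto intro!: derivative_eq_intros bump_algebra.intros)
qed

lemma smooth_bump_algebra:
  assumes "f \<in> bump_algebra" shows "smooth (\<lambda>x. complex_of_real (f x))"
proof (rule smooth_by_closure[where S = "(\<lambda>f x. complex_of_real (f x)) ` bump_algebra"])
  fix h assume "h \<in> (\<lambda>f x. complex_of_real (f x)) ` bump_algebra"
  then obtain f where f: "f \<in> bump_algebra" "h = (\<lambda>x. complex_of_real (f x))" by blast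
  from bump_algebra_deriv[OF f(1)] obtain f' where f': "f' \<in> bump_algebra" "\<forall>x. (f has_real_derivative f' x) (at x)" by blast
  then show "\<exists>f'\<in>(\<lambda>f x. complex_of_real (f x)) ` bump_algebra. \<forall>x. (h has_vector_derivative f' x) (at x)"
    unfolding f(2) by (intro bexI[of _ "\<lambda>x. complex_of_real (f' x)"] allI has_vector_derivative_of_real)
      (auto simp: has_real_derivative_iff_has_vector_derivative)
qed (use assms in auto)

text \<open>The product is supported in $[a, b]$, and scaling both arguments by \<open>n\<close> drives it to 1 in the
  interior because $e^{-1/(nt)} \to 1$. Thus test functions approximate the indicator of an
  interval pointwise and boundedly. The sums are spelled out so that the arguments have the affine form
  of \<open>bump_algebra.base\<close>.\<close>

definition bump :: "real \<Rightarrow> real \<Rightarrow> nat \<Rightarrow> real \<Rightarrow> real" where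
  "bump a b n x = flat_exp 0 (real n * x + (- real n * a)) * flat_exp 0 (- real n * x + real n * b)"

lemma bump_bounds: "0 \<le> bump a b n x" "bump a b n x \<le> 1"
proof -
  have *: "0 \<le> flat_exp 0 t" "flat_exp 0 t \<le> 1" for t by (auto simp: flat_exp_def)
  then show "0 \<le> bump a b n x" "bump a b n x \<le> 1"
    unfolding bump_def by (auto intro!: mult_le_one)
qed

lemma bump_outside: "x \<notin> {a<..<b} \<Longrightarrow> bump a b n x = 0"
proof -
  assume x: "x \<notin> {a<..<b}"
  have "real n * (x - a) \<le> 0 \<or> real n * (b - x) \<le> 0"
    using x by (auto simp: mult_le_0_iff)
  then show ?thesis by (auto simp: bump_def flat_exp_def algebra_simps)
qed

lemma bump_limit: "(\<lambda>n. bump a b n x) \<longlonglongrightarrow> indicator {a<..<b} x"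
proof (cases "x \<in> {a<..<b}")
  case True
  have *: "(\<lambda>n. flat_exp 0 (real n * y)) \<longlonglongrightarrow> 1" if "0 < y" for y
  proof (rule Lim_transform_eventually)
    have "(\<lambda>n. 1 / real n) \<longlonglongrightarrow> 0" by (rule lim_1_over_n)
    then have "(\<lambda>n. exp (- (1 / real n * (1 / y)))) \<longlonglongrightarrow> exp (- (0 * (1 / y)))" by (intro tendsto_intros)
    then show "(\<lambda>n. exp (- (1 / real n * (1 / y)))) \<longlonglongrightarrow> 1" by simp
    show "\<forall>\<^sub>F n in sequentially. exp (- (1 / real n * (1 / y))) = flat_exp 0 (real n * y)"
      using eventually_gt_at_top[of 0] by eventually_elim (use that in \<open>auto simp: flat_exp_def\<close>)
  qed
  have "(\<lambda>n. flat_exp 0 (real n * (x - a)) * flat_exp 0 (real n * (b - x))) \<longlonglongrightarrow> 1 * 1"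
    by (intro tendsto_mult *) (use True in auto)
  then show ?thesis using True by (simp add: bump_def algebra_simps)
next
  case False then show ?thesis by (simp add: bump_outside)
qed

lemma test_function_bump:
  assumes "0 < a" shows "test_function (\<lambda>x. complex_of_real (bump a b n x))"
  unfolding test_function_iff
proof (intro conjI exI)
  show "smooth (\<lambda>x. complex_of_real (bump a b n x))"
    unfolding bump_def by (intro smooth_bump_algebra bump_algebra.intros)
  show "0 < a" by fact
  show "\<forall>x. x \<notin> {a..b} \<longrightarrow> complex_of_real (bump a b n x) = 0"
    by (auto intro!: bump_outside)
qed


section \<open>The lemma of du Bois-Reymond\<close>

text \<open>The half-lines \<open>{..a}\<close> form an intersection-stable generator of the Borel sets, so by Dynkin's lemma all
  integrals over Borel sets vanish.\<close>

lemma AE_zero_of_integrals_atMost: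
  fixes f :: "real \<Rightarrow> complex"
  assumes f: "integrable lborel f" and z: "\<And>a. (LINT x|lborel. indicator {..a} x *\<^sub>R f x) = 0"
  shows "AE x in lborel. f x = 0"
proof (rule sigma_finite_measure.density_zero[OF lborel.sigma_finite_measure_axioms f])
  have [measurable]: "f \<in> borel_measurable borel" using f by (simp add: integrable_iff_bounded)
  have tot: "(LINT x|lborel. f x) = 0"
  proof -
    have "(\<lambda>n. LINT x|lborel. indicator {..real n} x *\<^sub>R f x) \<longlonglongrightarrow> (LINT x|lborel. f x)"
    proof (rule integral_dominated_convergence[where w = "\<lambda>x. norm (f x)"])
      show "AE x in lborel. (\<lambda>n. indicator {..real n} x *\<^sub>R f x) \<longlonglongrightarrow> f x"
      proof (intro AE_I2 tendsto_eventually)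
        fix x :: real
        have "\<forall>\<^sub>F n in sequentially. x \<le> real n"
          using filterlim_real_sequentially by (auto simp: filterlim_at_top)
        then show "\<forall>\<^sub>F n in sequentially. indicat_real {..real n} x *\<^sub>R f x = f x"
          by eventually_elim (auto simp: indicator_def)
      qed
    qed (use f in \<open>auto simp: indicator_def\<close>)
    then show ?thesis by (simp add: z LIMSEQ_const_iff)
  qed
  have G: "Int_stable (range (\<lambda>a. {..a::real}))" "range (\<lambda>a. {..a::real}) \<subseteq> Pow UNIV"
    by (auto simp: Int_stable_def)
  fix A :: "real set" assume "A \<in> sets lborel"
  then have "A \<in> sigma_sets UNIV (range (\<lambda>a. {..a}))"
    by (simp add: borel_eq_atMost sets_measure_of)
  then show "set_lebesgue_integral lborel A f = 0"
  proof (induction rule: sigma_sets_induct_disjoint[OF G, consumes 1])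
    fix A assume A: "A \<in> sigma_sets UNIV (range (\<lambda>a. {..a::real}))" and IH: "set_lebesgue_integral lborel A f = 0"
    then have [measurable]: "A \<in> sets borel" by (simp add: borel_eq_atMost sets_measure_of)
    have "set_lebesgue_integral lborel (UNIV - A) f = (LINT x|lborel. f x - indicator A x *\<^sub>R f x)"
      unfolding set_lebesgue_integral_def
      by (intro Bochner_Integration.integral_cong) (auto simp: indicator_def)
    also have "\<dots> = 0" using f IH tot
      by (subst Bochner_Integration.integral_diff) (auto simp: set_lebesgue_integral_def intro!: integrable_mult_indicator)
    finally show "set_lebesgue_integral lborel (UNIV - A) f = 0" .
  next
    fix A :: "nat \<Rightarrow> real set"
    assume A: "disjoint_family A" "range A \<subseteq> sigma_sets UNIV (range (\<lambda>a. {..a::real}))" and IH: "\<And>i. set_lebesgue_integral lborel (A i) f = 0"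
    then have [measurable]: "A i \<in> sets borel" for i by (auto simp: borel_eq_atMost sets_measure_of)
    have "(LINT x:(\<Union>i. A i)|lborel. f x) = (\<Sum>i. LINT x:A i|lborel. f x)"
      using A(1) f by (intro lebesgue_integral_countable_add)
        (auto simp: disjoint_family_on_def set_integrable_def intro!: integrable_mult_indicator)
    then show "set_lebesgue_integral lborel (\<Union>i. A i) f = 0" using IH by simp
  qed (use z in \<open>auto simp: set_lebesgue_integral_def\<close>)
qed

lemma test_function_derivative:
  assumes "test_function \<eta>"
  shows "\<exists>\<eta>'. test_function \<eta>' \<and> (\<forall>x. (\<eta> has_vector_derivative \<eta>' x) (at x))"
proof -
  from assms obtain a b where s: "smooth \<eta>" and ab: "0 < a" "\<forall>x. x \<notin> {a..b} \<longrightarrow> \<eta> x = 0"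
    by (auto simp: test_function_iff)
  obtain \<eta>' where d: "smooth \<eta>'" "\<And>x. (\<eta> has_vector_derivative \<eta>' x) (at x)"
    using s smooth_derivative by blast
  have ab': "\<eta>' x = 0" if "x \<notin> {a..b}" for x
  proof -
    have "((\<lambda>_. 0) has_vector_derivative 0) (at x)" by simp
    then have "(\<eta> has_vector_derivative 0) (at x)"
      by (rule has_vector_derivative_transform_within_open[where S = "- {a..b}"]) (use ab that in auto)
    then show ?thesis using vector_derivative_unique_at d(2) by blast
  qed
  have "test_function \<eta>'" unfolding test_function_iff using d(1) ab(1) ab' by blast
  with d(2) show ?thesis by blast
qed

lemma test_function_continuous: "test_function \<eta> \<Longrightarrow> continuous_on UNIV \<eta>"
  by (simp add: test_function_iff smooth_continuous)

lemma test_function_0: "test_function \<eta> \<Longrightarrow> \<eta> 0 = 0"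
  by (force simp: test_function_iff)

lemma test_function_vanishes:
  assumes "test_function \<eta>"
  shows "\<exists>b>0. \<forall>x\<ge>b. \<eta> x = 0"
proof -
  from assms obtain a b where "\<forall>x. x \<notin> {a..b} \<longrightarrow> \<eta> x = 0" by (auto simp: test_function_iff)
  then have "\<eta> x = 0" if "\<bar>b\<bar> + 1 \<le> x" for x
    using that by (metis abs_ge_self add_le_same_cancel1 atLeastAtMost_iff dual_order.trans not_one_le_zero)
  then show ?thesis by (intro exI[of _ "\<bar>b\<bar> + 1"]) auto
qed

lemma loc_integrable_test: "test_function \<eta> \<Longrightarrow> loc_integrable \<eta>"
  by (intro loc_integrable_cont test_function_continuous)

lemma loc_integrable_compact_support:
  assumes "loc_integrable h" "\<And>x. b \<le> x \<Longrightarrow> h x = 0"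
  shows "integrable halfline h" "(LINT x|halfline. h x) = integral_from_0 h b"
proof -
  have "(\<lambda>x. indicator {..b} x * h x) = h" using assms(2) by (auto simp: indicator_def fun_eq_iff)
  then show "integrable halfline h" "(LINT x|halfline. h x) = integral_from_0 h b"
    using loc_integrableD(2)[OF assms(1), of b] by (simp_all add: integral_from_0_def)
qed

lemma integrable_mult_test:
  assumes f: "loc_integrable f" and "test_function \<eta>"
  shows "integrable halfline (\<lambda>x. f x * \<eta> x)"
proof -
  obtain b where "0 < b" "\<And>x. b \<le> x \<Longrightarrow> \<eta> x = 0" using test_function_vanishes[OF assms(2)] by blast
  then show ?thesis
    using loc_integrable_compact_support(1)[OF loc_integrable_mult_continuous[OF f test_function_continuous[OF assms(2)]], of b]
    by (simp add: mult.commute)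
qed

text \<open>Bump functions converge boundedly to indicators of intervals, so the integral of \<open>f\<close> over each
  compact subinterval of the open half-line vanishes. As \<open>f\<close> is only locally integrable, the previous
  lemma is applied to its restrictions to $(1/n, n)$.\<close>

lemma fundamental_lemma_of_variations:
  assumes f: "loc_integrable f" and z: "\<And>\<eta>. test_function \<eta> \<Longrightarrow> (LINT x|halfline. f x * \<eta> x) = 0"
  shows "AE x in halfline. f x = 0"
proof -
  note [measurable] = loc_integrableD(1)[OF f]
  have I: "(LINT x|halfline. f x * indicator {a<..<b} x) = 0" if "0 < a" for a b
  proof -
    have "(\<lambda>n. LINT x|halfline. f x * complex_of_real (bump a b n x)) \<longlonglongrightarrow> (LINT x|halfline. f x * of_real (indicator {a<..<b} x))"
    proof (rule integral_dominated_convergence)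
      show "integrable halfline (\<lambda>x. cmod (indicator {..b} x * f x))"
        using loc_integrableD(2)[OF f] by (rule integrable_norm)
      show "AE x in halfline. (\<lambda>n. f x * complex_of_real (bump a b n x)) \<longlonglongrightarrow> f x * of_real (indicator {a<..<b} x)"
        by (intro AE_I2 tendsto_intros bump_limit)
      show "AE x in halfline. norm (f x * complex_of_real (bump a b n x)) \<le> cmod (indicator {..b} x * f x)" for n
      proof (intro AE_I2)
        fix x
        show "norm (f x * complex_of_real (bump a b n x)) \<le> cmod (indicator {..b} x * f x)"
          using bump_bounds[of a b n x] bump_outside[of x a b n]
          by (cases "x \<in> {a<..<b}") (auto simp: norm_mult mult_left_le)
      qed
      show "(\<lambda>x. f x * complex_of_real (bump a b n x)) \<in> borel_measurable halfline" for n
        by (rule borel_measurable_integrable, rule integrable_mult_test[OF f test_function_bump[OF that]])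
    qed measurable
    then have "(LINT x|halfline. f x * of_real (indicator {a<..<b} x)) = 0"
      by (simp add: z[OF test_function_bump[OF that]] LIMSEQ_const_iff)
    moreover have "(of_real (indicator {a<..<b} x) :: complex) = indicator {a<..<b} x" for x
      by (simp add: indicator_def)
    ultimately show ?thesis by simp
  qed
  have "AE x in halfline. \<forall>n. x \<in> {1 / real (Suc n)<..<real (Suc n)} \<longrightarrow> f x = 0"
  proof (subst AE_all_countable, intro allI)
    fix n
    define a where "a = 1 / real (Suc n)"
    define b where "b = real (Suc n)"
    have a: "0 < a" by (simp add: a_def)
    define g where "g = (\<lambda>x. indicator {0<..} x *\<^sub>R (f x * indicator {a<..<b} x))"
    have "integrable halfline (\<lambda>x. f x * indicator {a<..<b} x)"
      by (rule Bochner_Integration.integrable_bound[OF loc_integrableD(2)[OF f, of b]])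
        (auto simp: indicator_def[abs_def] norm_mult)
    then have "integrable lborel g" unfolding g_def by (simp add: integrable_halfline)
    moreover have "(LINT x|lborel. indicator {..c} x *\<^sub>R g x) = 0" for c
    proof -
      have "(LINT x|lborel. indicator {..c} x *\<^sub>R g x) = (LINT x|lborel. indicator {0<..} x *\<^sub>R (indicator {..c} x * (f x * indicator {a<..<b} x)))"
        unfolding g_def by (intro Bochner_Integration.integral_cong) (auto simp: indicator_def)
      also have "\<dots> = (LINT x|halfline. indicator {..c} x * (f x * indicator {a<..<b} x))"
        by (simp add: integral_halfline)
      also have "\<dots> = (LINT x|halfline. f x * indicator {a<..<min c b} x)"
      proof (rule integral_cong_AE)
        show "AE x in halfline. indicator {..c} x * (f x * indicator {a<..<b} x) = f x * indicator {a<..<min c b} x"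
          using AE_halfline_neq[of c] by eventually_elim (auto simp: indicator_def)
      qed (auto simp: indicator_def[abs_def])
      finally show ?thesis using I[OF a] by simp
    qed
    ultimately have "AE x in lborel. g x = 0" by (rule AE_zero_of_integrals_atMost)
    then show "AE x in halfline. x \<in> {1 / real (Suc n)<..<real (Suc n)} \<longrightarrow> f x = 0"
      unfolding AE_halfline by eventually_elim (auto simp: g_def a_def b_def)
  qed
  then show ?thesis
    using AE_space
  proof eventually_elim
    case (elim x)
    then have "0 < x" by simp
    obtain n where n: "max x (1 / x) < real n" using reals_Archimedean2 by blast
    have "1 / x < real (Suc n)" "x < real (Suc n)" using n by auto
    then have "1 / real (Suc n) < x" using \<open>0 < x\<close> by (simp add: field_simps)
    with elim \<open>x < real (Suc n)\<close> show "f x = 0" by (metis greaterThanLessThan_iff)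
  qed
qed

lemma not_AE_halfline_False: "\<not> (AE x in halfline. False)"
proof -
  have "emeasure halfline (space halfline) = emeasure lborel {0::real<..}"
    unfolding space_halfline by (simp add: halfline_def emeasure_restrict_space)
  moreover have "emeasure lborel {0<..1::real} \<le> emeasure lborel {0::real<..}" by (intro emeasure_mono) auto
  ultimately have "emeasure halfline (space halfline) \<noteq> 0" by auto
  moreover have "(AE x in halfline. False) \<longleftrightarrow> emeasure halfline (space halfline) = 0"
    using sets.top[of halfline] by (intro AE_iff_measurable) auto
  ultimately show ?thesis by blast
qed

lemma integration_by_parts_test:
  assumes f: "loc_integrable f" and F: "\<And>x. 0 < x \<Longrightarrow> F x = c + integral_from_0 f x"
    and "test_function \<eta>" and d: "\<And>x. (\<eta> has_vector_derivative \<eta>' x) (at x)" and t': "test_function \<eta>'"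
  shows "(LINT x|halfline. F x * \<eta>' x) = - (LINT x|halfline. f x * \<eta> x)"
proof -
  obtain b where b: "0 < b" "\<And>x. b \<le> x \<Longrightarrow> \<eta> x = 0"
    using test_function_vanishes[OF assms(3)] by blast
  obtain b' where b': "0 < b'" "\<And>x. b' \<le> x \<Longrightarrow> \<eta>' x = 0" using test_function_vanishes[OF t'] by blast
  define B where "B = max b b'"
  have lF: "loc_integrable (\<lambda>x. c + integral_from_0 f x)"
    by (intro loc_integrable_cont continuous_intros continuous_integral_from_0 f)
  have e: "\<eta> x = 0 + integral_from_0 \<eta>' x" if "0 < x" for x
    using integral_from_0_of_derivative[OF d test_function_continuous[OF t'], of x] that test_function_0[OF assms(3)] by simp
  have i1: "integrable halfline (\<lambda>x. f x * \<eta> x)" using integrable_mult_test[OF f] assms by blast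
  have i2: "integrable halfline (\<lambda>x. (c + integral_from_0 f x) * \<eta>' x)" by (rule integrable_mult_test[OF lF t'])
  have "integral_from_0 (\<lambda>t. f t * \<eta> t + F t * \<eta>' t) B = F B * \<eta> B"
    using product_rule[OF f loc_integrable_test[OF t'] F e, of B] b(1) by (simp add: B_def)
  then have "0 = integral_from_0 (\<lambda>t. f t * \<eta> t + F t * \<eta>' t) B" using b by (simp add: B_def)
  also have "\<dots> = (LINT t|halfline. f t * \<eta> t + (c + integral_from_0 f t) * \<eta>' t)"
    unfolding integral_from_0_def[of _ B]
    using b(2) b' by (intro Bochner_Integration.integral_cong) (auto simp: B_def indicator_def F)
  also have "\<dots> = (LINT t|halfline. f t * \<eta> t) + (LINT t|halfline. (c + integral_from_0 f t) * \<eta>' t)"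
    using i1 i2 by (rule Bochner_Integration.integral_add)
  also have "(LINT t|halfline. (c + integral_from_0 f t) * \<eta>' t) = (LINT t|halfline. F t * \<eta>' t)"
    by (intro Bochner_Integration.integral_cong) (auto simp: F)
  finally show ?thesis by (simp add: eq_neg_iff_add_eq_0 add.commute)
qed

text \<open>A vanishing integral is what makes the antiderivative vanish to the right of the support as well.\<close>

lemma test_antiderivative:
  assumes t: "test_function \<omega>" and z: "(LINT x|halfline. \<omega> x) = 0"
  obtains \<eta> where "test_function \<eta>" "\<And>x. (\<eta> has_vector_derivative \<omega> x) (at x)"
proof -
  from t obtain a b where s: "smooth \<omega>" and ab: "0 < a" "\<And>x. x \<notin> {a..b} \<Longrightarrow> \<omega> x = 0"
    by (auto simp: test_function_iff)
  have c: "continuous_on UNIV \<omega>" by (rule smooth_continuous[OF s])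
  then have "isCont \<omega> x" for x by (simp add: continuous_on_eq_continuous_at)
  then obtain F where F: "\<And>x. (F has_vector_derivative \<omega> x) (at x)"
    using einterval_antiderivative[of "-\<infinity>" \<infinity> \<omega>] by auto
  define \<eta> where "\<eta> = (\<lambda>x. F x - F 0)"
  have d: "(\<eta> has_vector_derivative \<omega> x) (at x)" for x
    unfolding \<eta>_def using F by (auto intro!: derivative_eq_intros)
  have p: "\<eta> x = integral_from_0 \<omega> x" if "0 \<le> x" for x
    using integral_from_0_of_derivative[OF F c that] by (simp add: \<eta>_def)
  have "\<eta> x = 0" if "x < a" for x
  proof -
    have "((\<lambda>x. \<eta> x) has_vector_derivative 0) (at x within {..<a})" if "x \<in> {..<a}" for x
      using d[of x] ab(2)[of x] that by (auto intro: has_vector_derivative_at_within)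
    then obtain k where "\<And>x. x \<in> {..<a} \<Longrightarrow> \<eta> x = k"
      using has_vector_derivative_zero_constant[of "{..<a}" \<eta>] by auto
    then have "\<eta> x = \<eta> 0" using that ab(1) by auto
    then show ?thesis by (simp add: \<eta>_def)
  qed
  moreover have "\<eta> x = 0" if "max a b < x" for x
    using loc_integrable_compact_support(2)[OF loc_integrable_test[OF t], of x] p[of x] z ab that
    by fastforce
  ultimately have "\<forall>x. x \<notin> {a..max a b} \<longrightarrow> \<eta> x = 0" by (metis atLeastAtMost_iff not_le)
  with smooth_antiderivative[OF s d] ab have "test_function \<eta>" unfolding test_function_iff by blast
  with d show thesis using that by blast
qed

lemma test_function_lincomb:
  assumes "test_function f" "test_function g" shows "test_function (\<lambda>x. a * f x + b * g x)"
proof -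
  from assms obtain a1 b1 a2 b2 where "0 < a1" "0 < a2" "\<forall>x. x \<notin> {a1..b1} \<longrightarrow> f x = 0" "\<forall>x. x \<notin> {a2..b2} \<longrightarrow> g x = 0"
    by (auto simp: test_function_iff)
  then have "0 < min a1 a2 \<and> (\<forall>x. x \<notin> {min a1 a2..max b1 b2} \<longrightarrow> a * f x + b * g x = 0)"
    by (simp add: not_le min_le_iff_disj le_max_iff_disj)
  moreover have "smooth (\<lambda>x. a * f x + b * g x)"
    using assms by (intro smooth_lincomb) (auto simp: test_function_iff)
  ultimately show ?thesis unfolding test_function_iff by blast
qed

text \<open>Fix a test function $\theta$ with $\int\theta \ne 0$. For every test function $\omega$, the function
  $\omega - (\int\omega/\int\theta)\,\theta$ has integral zero, hence is a derivative of a test function. So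
  \<open>f\<close> minus a suitable constant annihilates every $\omega$.\<close>

lemma du_Bois_Reymond:
  assumes f: "loc_integrable f"
    and z: "\<And>\<eta> \<eta>'. test_function \<eta> \<Longrightarrow> test_function \<eta>' \<Longrightarrow> (\<And>x. (\<eta> has_vector_derivative \<eta>' x) (at x)) \<Longrightarrow>
       (LINT x|halfline. f x * \<eta>' x) = 0"
  shows "\<exists>C. AE x in halfline. f x = C"
proof -
  \<comment> \<open>If all integrals of test functions were zero, the constant 1 would vanish almost everywhere.\<close>
  obtain \<theta> where \<theta>: "test_function \<theta>" "(LINT x|halfline. \<theta> x) \<noteq> 0"
  proof (rule ccontr)
    assume "\<not> thesis"
    then have "AE x in halfline. (1::complex) = 0" using that by (intro fundamental_lemma_of_variations loc_integrable_one) auto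
    then show False using not_AE_halfline_False by simp
  qed
  define C where "C = (LINT x|halfline. f x * \<theta> x) / (LINT x|halfline. \<theta> x)"
  have "AE x in halfline. f x - C = 0"
  proof (rule fundamental_lemma_of_variations)
    show "loc_integrable (\<lambda>x. f x - C)"
      using loc_integrable_diff[OF f loc_integrable_cmult[OF loc_integrable_one, of C]] by simp
    fix \<omega> assume \<omega>: "test_function \<omega>"
    note i = integrable_mult_test[OF loc_integrable_one \<omega>] integrable_mult_test[OF loc_integrable_one \<theta>(1)]
      integrable_mult_test[OF f \<omega>] integrable_mult_test[OF f \<theta>(1)]
    define r where "r = (LINT x|halfline. \<omega> x) / (LINT x|halfline. \<theta> x)"
    define \<omega>' where "\<omega>' = (\<lambda>x. 1 * \<omega> x + (- r) * \<theta> x)"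
    have t: "test_function \<omega>'" unfolding \<omega>'_def by (rule test_function_lincomb[OF \<omega> \<theta>(1)])
    have "(LINT x|halfline. \<omega>' x) = 0" using i \<theta>(2) by (simp add: \<omega>'_def r_def)
    then obtain \<eta> where "test_function \<eta>" "\<And>x. (\<eta> has_vector_derivative \<omega>' x) (at x)"
      using test_antiderivative[OF t] by blast
    then have "0 = (LINT x|halfline. f x * \<omega>' x)" using z t by simp
    also have "\<dots> = (LINT x|halfline. f x * \<omega> x - r * (f x * \<theta> x))"
      by (simp add: \<omega>'_def algebra_simps)
    also have "\<dots> = (LINT x|halfline. f x * \<omega> x) - C * (LINT x|halfline. \<omega> x)"
      using i by (simp add: r_def C_def)
    also have "\<dots> = (LINT x|halfline. (f x - C) * \<omega> x)"
      using i by (simp add: left_diff_distrib)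
    finally show "(LINT x|halfline. (f x - C) * \<omega> x) = 0" by simp
  qed
  then show ?thesis by (intro exI[of _ C]) simp
qed


section \<open>$H^1$ functions as indefinite integrals\<close>

lemma L2_eq_rep: "L2_eq (rep_L2 \<psi>) (rep_L2 \<psi>)"
  using Quotient_rep_reflp[OF Quotient_L2] .

lemma square_integrable_rep [simp]: "square_integrable (rep_L2 \<psi>)"
  using L2_eq_rep[of \<psi>] by (simp add: L2_eq_def)

lemma measurable_rep [measurable]: "rep_L2 \<psi> \<in> borel_measurable halfline"
  using square_integrable_rep[of \<psi>] by (simp add: square_integrable_def)

lemma loc_integrable_rep [simp]: "loc_integrable (rep_L2 \<psi>)"
  by (simp add: loc_integrable_square_integrable)

lemma abs_rep_L2: "abs_L2 (rep_L2 \<psi>) = \<psi>"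
  using Quotient_abs_rep[OF Quotient_L2] .

lemma rep_abs_L2: "square_integrable f \<Longrightarrow> AE x in halfline. rep_L2 (abs_L2 f) x = f x"
  using Quotient_rep_abs[OF Quotient_L2, of f] by (simp add: L2_eq_def)

lemma L2_eqI: "AE x in halfline. rep_L2 \<psi> x = rep_L2 \<phi> x \<Longrightarrow> \<psi> = \<phi>"
  using Quotient_rel_rep[OF Quotient_L2, of \<psi> \<phi>] by (simp add: L2_eq_def)

lemma rep_add: "AE x in halfline. rep_L2 (\<psi> + \<phi>) x = rep_L2 \<psi> x + rep_L2 \<phi> x"
  using rep_abs_L2[OF square_integrable_add[of "rep_L2 \<psi>" "rep_L2 \<phi>"]]
    plus_L2.abs_eq[OF L2_eq_rep L2_eq_rep, of \<psi> \<phi>] by (simp add: abs_rep_L2)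

lemma rep_scaleC: "AE x in halfline. rep_L2 (a *\<^sub>C \<psi>) x = a * rep_L2 \<psi> x"
  using rep_abs_L2[OF square_integrable_cmult[of "rep_L2 \<psi>" a]]
    scaleC_L2.abs_eq[OF L2_eq_rep, of a \<psi>] by (simp add: abs_rep_L2)

lemma rep_scaleR: "AE x in halfline. rep_L2 (a *\<^sub>R \<psi>) x = a * rep_L2 \<psi> x"
  using rep_scaleC[of "complex_of_real a"] by (simp add: scaleC_of_real)

lemma rep_diff: "AE x in halfline. rep_L2 (\<psi> - \<phi>) x = rep_L2 \<psi> x - rep_L2 \<phi> x"
proof -
  have "\<psi> - \<phi> = \<psi> + (- 1) *\<^sub>R \<phi>" by simp
  then show ?thesis
    using rep_add[of \<psi> "(- 1) *\<^sub>R \<phi>"] rep_scaleR[of "-1" \<phi>] by auto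
qed

lemma rep_zero: "AE x in halfline. rep_L2 0 x = 0"
  using rep_abs_L2[OF square_integrable_zero] by (simp add: zero_L2_def)

lemma norm_L2_rep_square: "(norm \<psi>)\<^sup>2 = (LINT x|halfline. (cmod (rep_L2 \<psi> x))\<^sup>2)"
  using norm_L2.abs_eq[OF L2_eq_rep, of \<psi>] by (simp add: abs_rep_L2)

lemma norm_L2_abs_square: "square_integrable f \<Longrightarrow> (norm (abs_L2 f))\<^sup>2 = (LINT x|halfline. (cmod (f x))\<^sup>2)"
  using norm_L2.abs_eq[of f] by (simp add: L2_eq_def)

lemma integrable_rep: "integrable halfline (\<lambda>x. (cmod (rep_L2 \<psi> x))\<^sup>2)"
  using square_integrable_rep[of \<psi>] by (simp add: square_integrable_def)

text \<open>This relation records weak derivative and boundary value together; all computations in $H^1$ are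
  carried out with it.\<close>

definition primitive_of :: "L2 \<Rightarrow> L2 \<Rightarrow> complex \<Rightarrow> bool" where
  "primitive_of \<psi> \<phi> c \<longleftrightarrow> (AE x in halfline. rep_L2 \<psi> x = c + integral_from_0 (rep_L2 \<phi>) x)"

text \<open>If $\varphi$ is a weak derivative of $\psi$, then $\psi - \int_0^x\varphi$ has weak derivative zero, so it is
  constant by du Bois-Reymond. The converse is the product rule with a test function as second factor.\<close>

lemma has_weak_deriv_iff: "has_weak_deriv \<psi> \<phi> \<longleftrightarrow> (\<exists>c. primitive_of \<psi> \<phi> c)"
proof
  have c: "continuous_on UNIV (integral_from_0 (rep_L2 \<phi>))" by (intro continuous_integral_from_0) simp
  have l: "loc_integrable (\<lambda>x. c + integral_from_0 (rep_L2 \<phi>) x)" for c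
    by (intro loc_integrable_cont continuous_intros c)
  note [measurable] = l[THEN loc_integrableD(1)]
  {
    assume w: "has_weak_deriv \<psi> \<phi>"
    have "\<exists>C. AE x in halfline. rep_L2 \<psi> x - (0 + integral_from_0 (rep_L2 \<phi>) x) = C"
    proof (rule du_Bois_Reymond)
      show "loc_integrable (\<lambda>x. rep_L2 \<psi> x - (0 + integral_from_0 (rep_L2 \<phi>) x))"
        by (intro loc_integrable_diff l) simp
      fix \<eta> \<eta>' assume t: "test_function \<eta>" "test_function \<eta>'" and d: "\<And>x. (\<eta> has_vector_derivative \<eta>' x) (at x)"
      have "(LINT x|halfline. rep_L2 \<psi> x * \<eta>' x) = - (LINT x|halfline. rep_L2 \<phi> x * \<eta> x)"
        using w[unfolded has_weak_deriv_def, rule_format, OF t(1)] by (simp add: vector_derivative_at[OF d])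
      moreover have "(LINT x|halfline. (0 + integral_from_0 (rep_L2 \<phi>) x) * \<eta>' x) = - (LINT x|halfline. rep_L2 \<phi> x * \<eta> x)"
        by (rule integration_by_parts_test[OF _ _ t(1) d t(2)]) auto
      ultimately show "(LINT x|halfline. (rep_L2 \<psi> x - (0 + integral_from_0 (rep_L2 \<phi>) x)) * \<eta>' x) = 0"
        using integrable_mult_test[OF _ t(2), of "rep_L2 \<psi>"] integrable_mult_test[OF l[of 0] t(2)]
        by (simp add: left_diff_distrib)
    qed
    then show "\<exists>c. primitive_of \<psi> \<phi> c"
      unfolding primitive_of_def by (auto simp: diff_eq_eq)
  }
  assume "\<exists>c. primitive_of \<psi> \<phi> c"
  then obtain c where p: "primitive_of \<psi> \<phi> c" by blast
  show "has_weak_deriv \<psi> \<phi>"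
    unfolding has_weak_deriv_def
  proof (intro allI impI)
    fix \<eta> assume t: "test_function \<eta>"
    then obtain \<eta>' where t': "test_function \<eta>'" and d: "\<And>x. (\<eta> has_vector_derivative \<eta>' x) (at x)"
      using test_function_derivative by blast
    note [measurable] = loc_integrable_test[OF t', THEN loc_integrableD(1)]
    have "(LINT x|halfline. rep_L2 \<psi> x * vector_derivative \<eta> (at x)) = (LINT x|halfline. rep_L2 \<psi> x * \<eta>' x)"
      by (simp add: vector_derivative_at[OF d])
    also have "\<dots> = (LINT x|halfline. (c + integral_from_0 (rep_L2 \<phi>) x) * \<eta>' x)"
    proof (rule integral_cong_AE)
      show "AE x in halfline. rep_L2 \<psi> x * \<eta>' x = (c + integral_from_0 (rep_L2 \<phi>) x) * \<eta>' x"
        using p unfolding primitive_of_def by eventually_elim simp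
    qed measurable
    also have "\<dots> = - (LINT x|halfline. rep_L2 \<phi> x * \<eta> x)"
      by (rule integration_by_parts_test[OF _ _ t d t']) auto
    finally show "(LINT x|halfline. rep_L2 \<psi> x * vector_derivative \<eta> (at x)) = - (LINT x|halfline. rep_L2 \<phi> x * \<eta> x)" .
  qed
qed

lemma has_weak_deriv_unique:
  assumes "has_weak_deriv \<psi> \<phi>" "has_weak_deriv \<psi> \<phi>'" shows "\<phi> = \<phi>'"
proof -
  have "AE x in halfline. rep_L2 \<phi> x - rep_L2 \<phi>' x = 0"
  proof (rule fundamental_lemma_of_variations)
    fix \<eta> assume t: "test_function \<eta>"
    then have "(LINT x|halfline. rep_L2 \<phi> x * \<eta> x) = (LINT x|halfline. rep_L2 \<phi>' x * \<eta> x)"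
      using assms unfolding has_weak_deriv_def by (metis neg_equal_iff_equal)
    then show "(LINT x|halfline. (rep_L2 \<phi> x - rep_L2 \<phi>' x) * \<eta> x) = 0"
      using integrable_mult_test[OF _ t, of "rep_L2 \<phi>"] integrable_mult_test[OF _ t, of "rep_L2 \<phi>'"]
      by (simp add: left_diff_distrib)
  qed (intro loc_integrable_diff loc_integrable_rep)
  then show ?thesis by (intro L2_eqI) simp
qed

text \<open>An almost everywhere property holds at points arbitrarily close to 0; this transports it to boundary
  values of continuous functions.\<close>

lemma AE_halfline_near_0:
  assumes "AE x in halfline. P x" "0 < d"
  shows "\<exists>x. 0 < x \<and> x < d \<and> P x"
proof (rule ccontr)
  assume "\<not> ?thesis"
  then have "AE x in lborel. x \<notin> {0<..<d}"
    using assms(1) unfolding AE_halfline by (auto elim!: eventually_mono)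
  then have "{0<..<d} \<in> null_sets lborel" by (subst AE_iff_null_sets) auto
  then show False using assms(2) by (auto simp: null_sets_def)
qed

lemma value_at_0_eq:
  assumes p: "primitive_of \<psi> \<phi> c" shows "value_at_0 \<psi> = c"
  unfolding value_at_0_def
proof (rule the_equality)
  have c: "continuous_on UNIV (\<lambda>x. c + integral_from_0 (rep_L2 \<phi>) x)" by (intro continuous_intros continuous_integral_from_0) simp
  have p': "AE x in halfline. c + integral_from_0 (rep_L2 \<phi>) x = rep_L2 \<psi> x"
    using p unfolding primitive_of_def by eventually_elim simp
  show "\<exists>g. continuous_on {0..} g \<and> (AE x in halfline. g x = rep_L2 \<psi> x) \<and> g 0 = c"
    using p' continuous_on_subset[OF c] by (intro exI[of _ "\<lambda>x. c + integral_from_0 (rep_L2 \<phi>) x"]) (auto simp: integral_from_0_nonpos)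
  fix v assume "\<exists>g. continuous_on {0..} g \<and> (AE x in halfline. g x = rep_L2 \<psi> x) \<and> g 0 = v"
  then obtain g where g: "continuous_on {0..} g" "AE x in halfline. g x = rep_L2 \<psi> x" "g 0 = v" by blast
  define h where "h = (\<lambda>x. g x - (c + integral_from_0 (rep_L2 \<phi>) x))"
  have ch: "continuous_on {0..} h"
    unfolding h_def by (intro continuous_on_diff g continuous_on_subset[OF c]) auto
  have h0: "AE x in halfline. h x = 0"
    using g(2) p' unfolding h_def by eventually_elim simp
  have "h 0 = 0"
  proof (rule ccontr)
    assume "h 0 \<noteq> 0"
    then obtain d where d: "0 < d" "\<And>x. 0 \<le> x \<Longrightarrow> dist x 0 < d \<Longrightarrow> dist (h x) (h 0) < norm (h 0)"
      using ch unfolding continuous_on_iff by (metis atLeast_iff order_refl zero_less_norm_iff)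
    from AE_halfline_near_0[OF h0 d(1)] obtain x where "0 < x" "x < d" "h x = 0" by blast
    with d(2)[of x] show False by simp
  qed
  then show "v = c" using g(3) by (simp add: h_def integral_from_0_nonpos)
qed

lemma weak_deriv_eq: "primitive_of \<psi> \<phi> c \<Longrightarrow> weak_deriv \<psi> = \<phi>"
  unfolding weak_deriv_def using has_weak_deriv_iff has_weak_deriv_unique by (blast intro: the_equality)

lemma primitive_of_imp_H1: "primitive_of \<psi> \<phi> c \<Longrightarrow> \<psi> \<in> H1"
  unfolding H1_def using has_weak_deriv_iff by blast

lemma H1_imp_primitive_of: "\<psi> \<in> H1 \<Longrightarrow> primitive_of \<psi> (weak_deriv \<psi>) (value_at_0 \<psi>)"
  unfolding H1_def using has_weak_deriv_iff value_at_0_eq weak_deriv_eq by auto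

lemma primitive_of_iff: "primitive_of \<psi> \<phi> c \<longleftrightarrow> \<psi> \<in> H1 \<and> weak_deriv \<psi> = \<phi> \<and> value_at_0 \<psi> = c"
  using H1_imp_primitive_of primitive_of_imp_H1 weak_deriv_eq value_at_0_eq by blast

lemma primitive_of_add:
  assumes "primitive_of \<psi> \<phi> c" "primitive_of \<psi>' \<phi>' c'"
  shows "primitive_of (\<psi> + \<psi>') (\<phi> + \<phi>') (c + c')"
proof -
  have eq: "integral_from_0 (rep_L2 (\<phi> + \<phi>')) x = integral_from_0 (rep_L2 \<phi>) x + integral_from_0 (rep_L2 \<phi>') x" for x
    by (subst integral_from_0_add[symmetric]) (auto intro!: integral_from_0_cong_AE rep_add)
  from assms rep_add[of \<psi> \<psi>'] show ?thesis unfolding primitive_of_def by eventually_elim (simp add: eq)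
qed

lemma primitive_of_scaleC:
  assumes "primitive_of \<psi> \<phi> c"
  shows "primitive_of (a *\<^sub>C \<psi>) (a *\<^sub>C \<phi>) (a * c)"
proof -
  have eq: "integral_from_0 (rep_L2 (a *\<^sub>C \<phi>)) x = a * integral_from_0 (rep_L2 \<phi>) x" for x
    by (subst integral_from_0_cmult[symmetric]) (auto intro!: integral_from_0_cong_AE rep_scaleC)
  from assms rep_scaleC[of a \<psi>] show ?thesis
    unfolding primitive_of_def by eventually_elim (simp add: eq distrib_left)
qed

lemma primitive_of_scaleR:
  "primitive_of \<psi> \<phi> c \<Longrightarrow> primitive_of (a *\<^sub>R \<psi>) (a *\<^sub>R \<phi>) (a * c)"
  using primitive_of_scaleC[of \<psi> \<phi> c "complex_of_real a"] by (simp add: scaleC_of_real)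

lemma primitive_of_diff:
  assumes "primitive_of \<psi> \<phi> c" "primitive_of \<psi>' \<phi>' c'"
  shows "primitive_of (\<psi> - \<psi>') (\<phi> - \<phi>') (c - c')"
  using primitive_of_add[OF assms(1) primitive_of_scaleR[OF assms(2), of "-1"]] by simp


section \<open>Completeness of $L^2$\<close>

lemma nn_integral_rep: "(\<integral>\<^sup>+x. ennreal ((cmod (rep_L2 \<psi> x))\<^sup>2) \<partial>halfline) = ennreal ((norm \<psi>)\<^sup>2)"
  unfolding norm_L2_rep_square by (intro nn_integral_eq_integral integrable_rep) simp

lemma nn_integral_rep_diff:
  "(\<integral>\<^sup>+x. ennreal ((cmod (rep_L2 \<psi> x - rep_L2 \<phi> x))\<^sup>2) \<partial>halfline) = ennreal ((norm (\<psi> - \<phi>))\<^sup>2)"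
proof -
  have "(\<integral>\<^sup>+x. ennreal ((cmod (rep_L2 \<psi> x - rep_L2 \<phi> x))\<^sup>2) \<partial>halfline) = (\<integral>\<^sup>+x. ennreal ((cmod (rep_L2 (\<psi> - \<phi>) x))\<^sup>2) \<partial>halfline)"
    using rep_diff[of \<psi> \<phi>] by (intro nn_integral_cong_AE) (auto elim!: eventually_mono)
  then show ?thesis by (simp add: nn_integral_rep)
qed

lemma square_integrable_bound:
  assumes [measurable]: "f \<in> borel_measurable halfline"
    and b: "(\<integral>\<^sup>+x. ennreal ((cmod (f x))\<^sup>2) \<partial>halfline) \<le> ennreal (B\<^sup>2)" and "0 \<le> B"
  shows "square_integrable f" "norm (abs_L2 f) \<le> B"
proof -
  have "(\<integral>\<^sup>+x. ennreal (norm ((cmod (f x))\<^sup>2)) \<partial>halfline) < \<infinity>"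
    using b by (simp add: le_less_trans)
  then show s: "square_integrable f"
    unfolding square_integrable_def by (intro conjI integrableI_bounded) auto
  have "ennreal ((norm (abs_L2 f))\<^sup>2) = (\<integral>\<^sup>+x. ennreal ((cmod (f x))\<^sup>2) \<partial>halfline)"
    unfolding norm_L2_abs_square[OF s] using s by (intro nn_integral_eq_integral[symmetric]) (auto simp: square_integrable_def)
  with b have "(norm (abs_L2 f))\<^sup>2 \<le> B\<^sup>2" by (metis ennreal_le_iff zero_le_power2)
  then show "norm (abs_L2 f) \<le> B" using \<open>0 \<le> B\<close> by (rule power2_le_imp_le)
qed

text \<open>With $d_k$ the modulus of the increments, $\int \sum_k 4^k d_k^2 \le \sum_k 4^{-k}$ is finite. So almost
  everywhere $4^k d_k^2$ is bounded in \<open>k\<close>, and the increments are dominated by a geometric series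
  of ratio 1/2.\<close>

lemma L2_fast_Cauchy_AE_convergent:
  assumes b: "\<And>k. norm (Y (Suc k) - Y k) \<le> (1/4) ^ k"
  shows "AE x in halfline. convergent (\<lambda>k. rep_L2 (Y k) x)"
proof -
  define d where "d = (\<lambda>k x. cmod (rep_L2 (Y (Suc k)) x - rep_L2 (Y k) x))"
  have [measurable]: "d k \<in> borel_measurable halfline" for k unfolding d_def by measurable
  have "(\<integral>\<^sup>+x. (\<Sum>k. ennreal (4 ^ k * (d k x)\<^sup>2)) \<partial>halfline) = (\<Sum>k. \<integral>\<^sup>+x. ennreal (4 ^ k * (d k x)\<^sup>2) \<partial>halfline)"
    by (rule nn_integral_suminf) measurable
  also have "\<dots> \<le> (\<Sum>k. ennreal ((1/4) ^ k))"
  proof (intro suminf_le summableI)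
    fix k
    have "(\<integral>\<^sup>+x. ennreal (4 ^ k * (d k x)\<^sup>2) \<partial>halfline) = ennreal (4 ^ k) * (\<integral>\<^sup>+x. ennreal ((d k x)\<^sup>2) \<partial>halfline)"
      by (subst nn_integral_cmult[symmetric]) (auto simp: ennreal_mult')
    also have "\<dots> = ennreal (4 ^ k * (norm (Y (Suc k) - Y k))\<^sup>2)"
      unfolding d_def nn_integral_rep_diff by (simp add: ennreal_mult')
    also have "\<dots> \<le> ennreal (4 ^ k * ((1/4) ^ k)\<^sup>2)"
      by (intro ennreal_leI mult_left_mono power_mono b) auto
    also have "4 ^ k * ((1/4) ^ k)\<^sup>2 = (1/4::real) ^ k"
      by (simp add: power2_eq_square flip: power_mult_distrib)
    finally show "(\<integral>\<^sup>+x. ennreal (4 ^ k * (d k x)\<^sup>2) \<partial>halfline) \<le> ennreal ((1/4) ^ k)" .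
  qed
  also have "\<dots> < \<infinity>"
    by (subst suminf_ennreal2) (auto intro!: summable_geometric)
  finally have "AE x in halfline. (\<Sum>k. ennreal (4 ^ k * (d k x)\<^sup>2)) \<noteq> \<infinity>"
    by (intro nn_integral_noteq_infinite) auto
  then show ?thesis
  proof eventually_elim
    case (elim x)
    then have s: "summable (\<lambda>k. 4 ^ k * (d k x)\<^sup>2)"
      by (intro summable_suminf_not_top) auto
    then obtain C where C: "\<And>k. 4 ^ k * (d k x)\<^sup>2 \<le> C"
      using convergent_imp_Bseq[OF convergentI[OF summable_LIMSEQ_zero[OF s]]] by (auto simp: Bseq_def)
    have "summable (\<lambda>k. rep_L2 (Y (Suc k)) x - rep_L2 (Y k) x)"
    proof (rule summable_comparison_test')
      show "summable (\<lambda>k. sqrt C * (1/2) ^ k)" by (intro summable_mult summable_geometric) auto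
      fix k
      have "(2 ^ k * d k x)\<^sup>2 = 4 ^ k * (d k x)\<^sup>2"
        by (simp add: power_mult_distrib flip: power_mult) (simp add: power_mult mult.commute[of k 2])
      with C[of k] have "2 ^ k * d k x \<le> sqrt C" by (intro real_le_rsqrt) simp
      then show "norm (rep_L2 (Y (Suc k)) x - rep_L2 (Y k) x) \<le> sqrt C * (1/2) ^ k"
        by (simp add: d_def field_simps)
    qed
    then have "convergent (\<lambda>n. \<Sum>k<n. rep_L2 (Y (Suc k)) x - rep_L2 (Y k) x)"
      by (simp add: summable_iff_convergent)
    then have "convergent (\<lambda>n. rep_L2 (Y n) x - rep_L2 (Y 0) x)"
      by (simp only: sum_lessThan_telescope[of "\<lambda>n. rep_L2 (Y n) x"])
    then show "convergent (\<lambda>n. rep_L2 (Y n) x)" by (simp add: convergent_diff_const_right_iff)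
  qed
qed

text \<open>The pointwise limit of a fast subsequence is the limit in norm: Fatou's lemma, applied along the
  subsequence, carries the Cauchy estimate over to it.\<close>

instance L2 :: banach
proof
  fix X :: "nat \<Rightarrow> L2" assume X: "Cauchy X"
  have "\<exists>M. \<forall>m\<ge>M. \<forall>n\<ge>M. norm (X m - X n) < (1/4) ^ k" for k :: nat
    using X unfolding Cauchy_iff by simp
  then obtain M where M: "\<And>k m n. M k \<le> m \<Longrightarrow> M k \<le> n \<Longrightarrow> norm (X m - X n) < (1/4) ^ (k::nat)" by metis
  \<comment> \<open>Summing makes \<open>r\<close> dominate \<open>M\<close> and increase at the same time.\<close>
  define r where "r k = (\<Sum>i\<le>k. M i) + k" for k
  have r: "M k \<le> r k" "r k \<le> r (Suc k)" "k \<le> r k" for k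
    by (auto simp: r_def sum.atMost_Suc intro!: trans_le_add1 member_le_sum)
  define Y where "Y k = X (r k)" for k
  have "norm (Y (Suc k) - Y k) \<le> (1/4) ^ k" for k
    unfolding Y_def by (intro less_imp_le M r order_trans[OF r(1) r(2)])
  then have conv: "AE x in halfline. convergent (\<lambda>k. rep_L2 (Y k) x)"
    by (rule L2_fast_Cauchy_AE_convergent)
  define f where "f x = lim (\<lambda>k. rep_L2 (Y k) x)" for x
  have [measurable]: "f \<in> borel_measurable halfline"
    unfolding f_def by (rule borel_measurable_lim_metric) measurable
  have bound: "square_integrable (\<lambda>x. f x - rep_L2 (X n) x) \<and> norm (abs_L2 (\<lambda>x. f x - rep_L2 (X n) x)) \<le> e"
    if e: "0 < e" and N: "\<And>j n. N \<le> j \<Longrightarrow> N \<le> n \<Longrightarrow> norm (X j - X n) < e" and n: "N \<le> n" for e N n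
  proof -
    have "(\<integral>\<^sup>+x. ennreal ((cmod (f x - rep_L2 (X n) x))\<^sup>2) \<partial>halfline)
       = (\<integral>\<^sup>+x. liminf (\<lambda>j. ennreal ((cmod (rep_L2 (Y j) x - rep_L2 (X n) x))\<^sup>2)) \<partial>halfline)"
    proof (rule nn_integral_cong_AE)
      show "AE x in halfline. ennreal ((cmod (f x - rep_L2 (X n) x))\<^sup>2) =
           liminf (\<lambda>j. ennreal ((cmod (rep_L2 (Y j) x - rep_L2 (X n) x))\<^sup>2))"
        using conv
      proof eventually_elim
        case (elim x)
        then have "(\<lambda>j. rep_L2 (Y j) x) \<longlonglongrightarrow> f x" by (simp add: f_def convergent_LIMSEQ_iff)
        then have "(\<lambda>j. ennreal ((cmod (rep_L2 (Y j) x - rep_L2 (X n) x))\<^sup>2)) \<longlonglongrightarrow> ennreal ((cmod (f x - rep_L2 (X n) x))\<^sup>2)"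
          by (intro tendsto_ennrealI tendsto_intros)
        then show ?case by (intro lim_imp_Liminf[symmetric]) auto
      qed
    qed
    also have "\<dots> \<le> liminf (\<lambda>j. \<integral>\<^sup>+x. ennreal ((cmod (rep_L2 (Y j) x - rep_L2 (X n) x))\<^sup>2) \<partial>halfline)"
      by (rule nn_integral_liminf) measurable
    also have "\<dots> = liminf (\<lambda>j. ennreal ((norm (Y j - X n))\<^sup>2))" by (simp add: nn_integral_rep_diff)
    also have "\<dots> \<le> limsup (\<lambda>j. ennreal ((norm (Y j - X n))\<^sup>2))" by (rule Liminf_le_Limsup) simp
    also have "\<dots> \<le> ennreal (e\<^sup>2)"
    proof (rule Limsup_bounded)
      show "\<forall>\<^sub>F j in sequentially. ennreal ((norm (Y j - X n))\<^sup>2) \<le> ennreal (e\<^sup>2)"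
        using eventually_ge_at_top[of N]
      proof eventually_elim
        case (elim j)
        then have "norm (Y j - X n) < e" unfolding Y_def by (intro N n) (rule order_trans[OF _ r(3)])
        then show ?case by (intro ennreal_leI power_mono) auto
      qed
    qed
    finally show ?thesis using square_integrable_bound[of "\<lambda>x. f x - rep_L2 (X n) x" e] e by auto
  qed
  have Nex: "\<exists>N. \<forall>j\<ge>N. \<forall>n\<ge>N. norm (X j - X n) < e" if "0 < e" for e
    using X that unfolding Cauchy_iff by auto
  obtain N1 where "\<And>j n. N1 \<le> j \<Longrightarrow> N1 \<le> n \<Longrightarrow> norm (X j - X n) < 1" using Nex[of 1] by auto
  then have "square_integrable (\<lambda>x. f x - rep_L2 (X N1) x)" using bound[of 1 N1 N1] by auto
  from square_integrable_add[OF this square_integrable_rep[of "X N1"]] have sf: "square_integrable f" by simp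
  have "X \<longlonglongrightarrow> abs_L2 f"
    unfolding LIMSEQ_iff
  proof (intro allI impI)
    fix e :: real assume "0 < e"
    then obtain N where N: "\<And>j n. N \<le> j \<Longrightarrow> N \<le> n \<Longrightarrow> norm (X j - X n) < e / 2" using Nex[of "e/2"] by auto
    have "norm (X n - abs_L2 f) < e" if "N \<le> n" for n
    proof -
      have b: "square_integrable (\<lambda>x. f x - rep_L2 (X n) x)" "norm (abs_L2 (\<lambda>x. f x - rep_L2 (X n) x)) \<le> e / 2"
        using bound[OF _ N that] \<open>0 < e\<close> by auto
      have "abs_L2 f - X n = abs_L2 (\<lambda>x. f x - rep_L2 (X n) x)"
      proof (rule L2_eqI)
        show "AE x in halfline. rep_L2 (abs_L2 f - X n) x = rep_L2 (abs_L2 (\<lambda>x. f x - rep_L2 (X n) x)) x"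
          using rep_abs_L2[OF b(1)] rep_abs_L2[OF sf] rep_diff[of "abs_L2 f" "X n"]
          by eventually_elim simp
      qed
      then show ?thesis using b(2) \<open>0 < e\<close> by (simp add: norm_minus_commute)
    qed
    then show "\<exists>no. \<forall>n\<ge>no. norm (X n - abs_L2 f) < e" by blast
  qed
  then show "convergent X" by (rule convergentI)
qed


section \<open>The equations $y' = \pm y + g$ on the half-line\<close>

lemma nn_integral_exp_kernel:
  assumes "0 \<le> x"
  shows "(\<integral>\<^sup>+t. ennreal (exp (- \<bar>x - t\<bar>)) \<partial>halfline) \<le> 2"
proof -
  have 1: "(\<integral>\<^sup>+t. ennreal (exp (x - t)) * indicator {x..} t \<partial>lborel) = ennreal (0 - (- exp (x - x)))"
  proof (rule nn_integral_FTC_atLeast[where F = "\<lambda>t. - exp (x - t)"])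
    have "\<forall>\<^sub>F t in at_top. x - t \<le> Z" for Z
      using eventually_ge_at_top[of "x - Z"] by eventually_elim simp
    then have "filterlim (\<lambda>t. x - t) at_bot at_top" by (simp add: filterlim_at_bot)
    then have "((\<lambda>t. - exp (x - t)) \<longlongrightarrow> - 0) at_top"
      by (intro tendsto_minus filterlim_compose[OF exp_at_bot])
    then show "((\<lambda>t. - exp (x - t)) \<longlongrightarrow> 0) at_top" by simp
  qed (auto intro!: derivative_eq_intros)
  have 2: "(\<integral>\<^sup>+t. ennreal (exp (t - x)) * indicator {0..x} t \<partial>lborel) = ennreal (exp (x - x) - exp (0 - x))"
    by (rule nn_integral_FTC_Icc[where F = "\<lambda>t. exp (t - x)"])
      (use assms in \<open>auto intro!: derivative_eq_intros simp flip: has_real_derivative_iff_has_vector_derivative\<close>)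
  have "(\<integral>\<^sup>+t. ennreal (exp (- \<bar>x - t\<bar>)) \<partial>halfline) = (\<integral>\<^sup>+t. ennreal (exp (- \<bar>x - t\<bar>)) * indicator {0<..} t \<partial>lborel)"
    unfolding halfline_def by (subst nn_integral_restrict_space) auto
  also have "\<dots> \<le> (\<integral>\<^sup>+t. ennreal (exp (x - t)) * indicator {x..} t + ennreal (exp (t - x)) * indicator {0..x} t \<partial>lborel)"
    by (intro nn_integral_mono) (auto simp: indicator_def)
  also have "\<dots> = ennreal (exp (x - x)) + ennreal (exp (x - x) - exp (0 - x))"
    by (subst nn_integral_add) (auto simp: 1 2)
  also have "\<dots> \<le> ennreal 1 + ennreal 1"
    by (intro add_mono ennreal_leI) auto
  finally show ?thesis by (simp flip: ennreal_plus)
qed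

text \<open>The Cauchy-Schwarz inequality for the weight $w(t) = e^{-|x-t|}$ of total mass at most 2.\<close>

lemma exp_kernel_Cauchy_Schwarz:
  assumes x: "0 \<le> x" and g: "square_integrable g" and K [measurable]: "K \<in> borel_measurable halfline"
    and b: "\<And>t. 0 < t \<Longrightarrow> cmod (K t) \<le> exp (- \<bar>x - t\<bar>)"
  shows "integrable halfline (\<lambda>t. K t * g t)"
    and "integrable halfline (\<lambda>t. exp (- \<bar>x - t\<bar>) * (cmod (g t))\<^sup>2)"
    and "(cmod (LINT t|halfline. K t * g t))\<^sup>2 \<le> 2 * (LINT t|halfline. exp (- \<bar>x - t\<bar>) * (cmod (g t))\<^sup>2)"
proof -
  have g2: "integrable halfline (\<lambda>t. (cmod (g t))\<^sup>2)" and [measurable]: "g \<in> borel_measurable halfline"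
    using g by (auto simp: square_integrable_def)
  define w where "w t = exp (- \<bar>x - t\<bar>)" for t
  have w: "0 \<le> w t" "w t \<le> 1" for t by (auto simp: w_def)
  have [measurable]: "w \<in> borel_measurable halfline" unfolding w_def by measurable
  have wn: "(\<integral>\<^sup>+t. ennreal (norm (w t)) \<partial>halfline) \<le> 2"
    using nn_integral_exp_kernel[OF x] by (simp add: w_def)
  then have iw: "integrable halfline w"
    by (intro integrableI_bounded) (auto intro: le_less_trans)
  have W: "(LINT t|halfline. w t) \<le> 2"
    using wn nn_integral_eq_integral[OF iw] w by (simp add: ennreal_le_iff flip: ennreal_numeral)
  show iwg2: "integrable halfline (\<lambda>t. exp (- \<bar>x - t\<bar>) * (cmod (g t))\<^sup>2)"
    by (rule Bochner_Integration.integrable_bound[OF g2])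
      (use w in \<open>auto simp: abs_mult w_def[symmetric] intro!: mult_left_le_one_le\<close>)
  note iwg2 = this[folded w_def]
  have iwg: "integrable halfline (\<lambda>t. w t * cmod (g t))"
  proof (rule Bochner_Integration.integrable_bound[OF Bochner_Integration.integrable_add[OF iw iwg2]])
    have "w t * cmod (g t) \<le> w t * (1 + (cmod (g t))\<^sup>2)" for t
      by (intro mult_left_mono w le_one_plus_square)
    then show "AE t in halfline. norm (w t * cmod (g t)) \<le> norm (w t + w t * (cmod (g t))\<^sup>2)"
      using w by (auto simp: distrib_left abs_mult)
  qed measurable
  have KW: "norm (K t * g t) \<le> w t * cmod (g t)" if "0 < t" for t
    unfolding norm_mult w_def using b[OF that] by (intro mult_right_mono) auto
  show iK: "integrable halfline (\<lambda>t. K t * g t)"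
    by (rule Bochner_Integration.integrable_bound[OF iwg]) (use KW w in \<open>auto simp: abs_mult\<close>)
  define X where "X = (LINT t|halfline. w t * cmod (g t))"
  have "cmod (LINT t|halfline. K t * g t) \<le> X"
    unfolding X_def using KW
    by (intro order_trans[OF integral_norm_bound] integral_mono integrable_norm iK iwg) auto
  then have "(cmod (LINT t|halfline. K t * g t))\<^sup>2 \<le> X\<^sup>2" by (intro power_mono) auto
  also have "X\<^sup>2 \<le> 2 * (LINT t|halfline. w t * (cmod (g t))\<^sup>2)"
  proof -
    \<comment> \<open>Completing the square at $X/2$ is optimal for total mass 2.\<close>
    have "0 \<le> (LINT t|halfline. w t * (cmod (g t) - X / 2)\<^sup>2)"
      by (intro Bochner_Integration.integral_nonneg mult_nonneg_nonneg w) auto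
    also have "\<dots> = (LINT t|halfline. w t * (cmod (g t))\<^sup>2 - X * (w t * cmod (g t)) + X\<^sup>2 / 4 * w t)"
      by (intro Bochner_Integration.integral_cong) (auto simp: power2_eq_square algebra_simps)
    also have "\<dots> = (LINT t|halfline. w t * (cmod (g t))\<^sup>2) - X * X + X\<^sup>2 / 4 * (LINT t|halfline. w t)"
      using iw iwg iwg2 by (simp add: X_def)
    also have "\<dots> \<le> (LINT t|halfline. w t * (cmod (g t))\<^sup>2) - X * X + X\<^sup>2 / 4 * 2"
      using W by (intro add_left_mono mult_left_mono) auto
    finally show ?thesis by (simp add: power2_eq_square)
  qed
  finally show "(cmod (LINT t|halfline. K t * g t))\<^sup>2 \<le> 2 * (LINT t|halfline. exp (- \<bar>x - t\<bar>) * (cmod (g t))\<^sup>2)"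
    by (simp add: w_def)
qed

text \<open>Schur's test: the row bound enters through the weighted Cauchy-Schwarz inequality, the column bound
  after exchanging the order of integration; each contributes a factor 2 to the squared norm.\<close>

lemma exp_kernel_operator_bounded:
  fixes K :: "real \<Rightarrow> real \<Rightarrow> complex" and g :: L2
  assumes K [measurable]: "(\<lambda>(x,t). K x t) \<in> borel_measurable (halfline \<Otimes>\<^sub>M halfline)"
    and b: "\<And>x t. 0 < x \<Longrightarrow> 0 < t \<Longrightarrow> cmod (K x t) \<le> exp (- \<bar>x - t\<bar>)"
  defines "h \<equiv> \<lambda>x. LINT t|halfline. K x t * rep_L2 g t"
  shows "square_integrable h" and "norm (abs_L2 h) \<le> 2 * norm g"
proof -
  have hm [measurable]: "h \<in> borel_measurable halfline"
    unfolding h_def by (rule halfline.borel_measurable_lebesgue_integral) measurable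
  have "(\<integral>\<^sup>+x. ennreal ((cmod (h x))\<^sup>2) \<partial>halfline)
     \<le> (\<integral>\<^sup>+x. (\<integral>\<^sup>+t. 2 * ennreal ((cmod (rep_L2 g t))\<^sup>2) * ennreal (exp (- \<bar>x - t\<bar>)) \<partial>halfline) \<partial>halfline)"
  proof (rule nn_integral_mono)
    fix x assume "x \<in> space halfline"
    then have x: "0 < x" by simp
    have m: "K x \<in> borel_measurable halfline"
      using measurable_compose[OF measurable_Pair1'[of x halfline halfline] K] x by simp
    note kp = exp_kernel_Cauchy_Schwarz[OF less_imp_le[OF x] square_integrable_rep[of g] m b[OF x]]
    have "ennreal ((cmod (h x))\<^sup>2) \<le> ennreal (2 * (LINT t|halfline. exp (- \<bar>x - t\<bar>) * (cmod (rep_L2 g t))\<^sup>2))"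
      unfolding h_def using kp(3) by (intro ennreal_leI) auto
    also have "\<dots> = ennreal (LINT t|halfline. 2 * (exp (- \<bar>x - t\<bar>) * (cmod (rep_L2 g t))\<^sup>2))" by simp
    also have "\<dots> = (\<integral>\<^sup>+t. ennreal (2 * (exp (- \<bar>x - t\<bar>) * (cmod (rep_L2 g t))\<^sup>2)) \<partial>halfline)"
      using kp(2) by (intro nn_integral_eq_integral[symmetric]) auto
    also have "\<dots> = (\<integral>\<^sup>+t. 2 * ennreal ((cmod (rep_L2 g t))\<^sup>2) * ennreal (exp (- \<bar>x - t\<bar>)) \<partial>halfline)"
      by (intro nn_integral_cong) (simp add: ennreal_mult' ennreal_mult'' mult_ac)
    finally show "ennreal ((cmod (h x))\<^sup>2) \<le> (\<integral>\<^sup>+t. 2 * ennreal ((cmod (rep_L2 g t))\<^sup>2) * ennreal (exp (- \<bar>x - t\<bar>)) \<partial>halfline)" .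
  qed
  also have "\<dots> = (\<integral>\<^sup>+t. (\<integral>\<^sup>+x. 2 * ennreal ((cmod (rep_L2 g t))\<^sup>2) * ennreal (exp (- \<bar>x - t\<bar>)) \<partial>halfline) \<partial>halfline)"
    by (rule halfline_pair.Fubini') measurable
  also have "\<dots> \<le> (\<integral>\<^sup>+t. 2 * ennreal ((cmod (rep_L2 g t))\<^sup>2) * 2 \<partial>halfline)"
  proof (rule nn_integral_mono)
    fix t assume "t \<in> space halfline"
    then have t: "0 < t" by simp
    have "(\<integral>\<^sup>+x. 2 * ennreal ((cmod (rep_L2 g t))\<^sup>2) * ennreal (exp (- \<bar>x - t\<bar>)) \<partial>halfline)
       = 2 * ennreal ((cmod (rep_L2 g t))\<^sup>2) * (\<integral>\<^sup>+x. ennreal (exp (- \<bar>t - x\<bar>)) \<partial>halfline)"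
      by (subst nn_integral_cmult) (auto simp: abs_minus_commute)
    also have "\<dots> \<le> 2 * ennreal ((cmod (rep_L2 g t))\<^sup>2) * 2"
      using t by (intro mult_left_mono nn_integral_exp_kernel) auto
    finally show "(\<integral>\<^sup>+x. 2 * ennreal ((cmod (rep_L2 g t))\<^sup>2) * ennreal (exp (- \<bar>x - t\<bar>)) \<partial>halfline) \<le> 2 * ennreal ((cmod (rep_L2 g t))\<^sup>2) * 2" .
  qed
  also have "\<dots> = 4 * ennreal ((norm g)\<^sup>2)"
  proof -
    have "(\<integral>\<^sup>+t. 2 * ennreal ((cmod (rep_L2 g t))\<^sup>2) * 2 \<partial>halfline) = (\<integral>\<^sup>+t. 4 * ennreal ((cmod (rep_L2 g t))\<^sup>2) \<partial>halfline)"
      by (intro nn_integral_cong) (simp add: mult.commute mult.left_commute flip: mult.assoc)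
    then show ?thesis by (simp add: nn_integral_cmult nn_integral_rep)
  qed
  also have "\<dots> = ennreal ((2 * norm g)\<^sup>2)"
    by (simp add: power_mult_distrib ennreal_mult)
  finally show "square_integrable h" "norm (abs_L2 h) \<le> 2 * norm g"
    using square_integrable_bound[OF hm, of "2 * norm g"] by auto
qed

lemma exp_eq_integral_from_0:
  assumes "0 < x"
  shows "exp (complex_of_real (s * x)) = 1 + integral_from_0 (\<lambda>t. of_real s * exp (complex_of_real (s * t))) x"
proof -
  have "((\<lambda>z. exp (of_real s * z)) has_field_derivative of_real s * exp (of_real s * of_real x)) (at (of_real x))" for x :: real
    by (auto intro!: derivative_eq_intros)
  from has_vector_derivative_real_field[OF this]
  have d: "((\<lambda>x. exp (complex_of_real (s * x))) has_vector_derivative of_real s * exp (complex_of_real (s * x))) (at x)" for x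
    by simp
  have "continuous_on UNIV (\<lambda>t. of_real s * exp (complex_of_real (s * t)))" by (intro continuous_intros)
  from integral_from_0_of_derivative[OF d this, of x] assms show ?thesis by simp
qed

text \<open>The solution formula is the product of an exponential and an indefinite integral, so the product rule
  shows that it satisfies the integrated equation.\<close>

lemma variation_of_constants:
  fixes s :: real and y0 :: complex
  assumes g: "loc_integrable g" and x: "0 < x"
  defines "F \<equiv> \<lambda>x. exp (complex_of_real (s * x)) * (y0 + integral_from_0 (\<lambda>t. exp (complex_of_real (- s * t)) * g t) x)"
  shows "F x = y0 + integral_from_0 (\<lambda>t. of_real s * F t + g t) x"
proof -
  let ?f = "\<lambda>t. of_real s * exp (complex_of_real (s * t))"
  let ?h = "\<lambda>t. exp (complex_of_real (- s * t)) * g t"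
  have e: "exp (complex_of_real (s * x)) = 1 + integral_from_0 ?f x" if "0 < x" for x
    using that by (rule exp_eq_integral_from_0)
  have lf: "loc_integrable ?f" by (intro loc_integrable_cont continuous_intros)
  have lh: "loc_integrable ?h" by (intro loc_integrable_mult_continuous g continuous_intros)
  have "F x = 1 * y0 + integral_from_0 (\<lambda>t. ?f t * (y0 + integral_from_0 ?h t) + exp (complex_of_real (s * t)) * ?h t) x"
    unfolding F_def by (rule product_rule[OF lf lh e refl x])
  also have "integral_from_0 (\<lambda>t. ?f t * (y0 + integral_from_0 ?h t) + exp (complex_of_real (s * t)) * ?h t) x = integral_from_0 (\<lambda>t. of_real s * F t + g t) x"
    by (intro integral_from_0_cong) (simp add: F_def mult.assoc exp_minus)
  finally show ?thesis by simp
qed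

text \<open>Passes from a square integrable solution of the integrated equation to its class in $L^2$.\<close>

lemma primitive_of_abs_L2:
  assumes F: "square_integrable F" and p: "\<And>x. 0 < x \<Longrightarrow> F x = y0 + integral_from_0 (\<lambda>t. of_real s * F t + rep_L2 g t) x"
  shows "primitive_of (abs_L2 F) (s *\<^sub>R abs_L2 F + g) y0"
proof -
  have [measurable]: "F \<in> borel_measurable halfline" using F by (simp add: square_integrable_def)
  have "AE x in halfline. rep_L2 (s *\<^sub>R abs_L2 F + g) x = of_real s * F x + rep_L2 g x"
    using rep_add[of "s *\<^sub>R abs_L2 F" g] rep_scaleR[of s "abs_L2 F"] rep_abs_L2[OF F] by eventually_elim simp
  then have e: "integral_from_0 (rep_L2 (s *\<^sub>R abs_L2 F + g)) x = integral_from_0 (\<lambda>t. of_real s * F t + rep_L2 g t) x" for x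
    by (intro integral_from_0_cong_AE) auto
  show ?thesis unfolding primitive_of_def
    using rep_abs_L2[OF F] AE_space by eventually_elim (use p e in auto)
qed

text \<open>The only square integrable solution is $y(x) = -\int_x^\infty e^{x-t} g(t)\,dt$; its initial value
  $-\int_0^\infty e^{-t} g(t)\,dt$ is determined by \<open>g\<close>.\<close>

lemma ode_solution_plus:
  "\<exists>y c. primitive_of y (y + g) c \<and> norm y \<le> 2 * norm g \<and> cmod c \<le> 2 * norm g"
proof -
  \<comment> \<open>The factors 1 and -1 in the exponents keep the shape of \<open>variation_of_constants\<close>.\<close>
  define h where "h = (\<lambda>t. exp (complex_of_real (- 1 * t)) * rep_L2 g t)"
  define c where "c = - (LINT t|halfline. h t)"
  have cm: "(\<lambda>t. exp (complex_of_real (- 1 * t))) \<in> borel_measurable halfline" by measurable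
  note kp = exp_kernel_Cauchy_Schwarz[of 0, OF _ square_integrable_rep[of g] cm, folded h_def]
  have ih: "integrable halfline h" by (rule kp) auto
  have "(cmod (LINT t|halfline. h t))\<^sup>2 \<le> 2 * (LINT t|halfline. exp (- \<bar>0 - t\<bar>) * (cmod (rep_L2 g t))\<^sup>2)"
    by (rule kp) auto
  also have "\<dots> \<le> 2 * (LINT t|halfline. (cmod (rep_L2 g t))\<^sup>2)"
    by (intro mult_left_mono integral_mono integrable_rep kp) (auto intro: mult_left_le_one_le)
  also have "\<dots> \<le> (2 * norm g)\<^sup>2" unfolding norm_L2_rep_square[symmetric] by (simp add: power_mult_distrib)
  finally have c: "cmod c \<le> 2 * norm g" unfolding c_def norm_minus_cancel by (rule power2_le_imp_le) simp
  define F where "F = (\<lambda>x. exp (complex_of_real (1 * x)) * (c + integral_from_0 h x))"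
  define K where "K = (\<lambda>x t. if x < t then - exp (complex_of_real (x - t)) else 0)"
  have FK: "F x = (LINT t|halfline. K x t * rep_L2 g t)" if "0 < x" for x
  proof -
    have "integrable halfline (\<lambda>t. indicator {..x} t * h t)"
      by (rule Bochner_Integration.integrable_bound[OF ih]) (auto simp: h_def indicator_def[abs_def])
    then have "F x = exp (complex_of_real x) * (LINT t|halfline. indicator {..x} t * h t - h t)"
      unfolding F_def c_def integral_from_0_def using ih by simp
    also have "\<dots> = (LINT t|halfline. exp (complex_of_real x) * (indicator {..x} t * h t - h t))" by simp
    also have "\<dots> = (LINT t|halfline. K x t * rep_L2 g t)"
      by (intro Bochner_Integration.integral_cong)
        (auto simp: K_def h_def indicator_def exp_diff exp_minus divide_inverse)
    finally show ?thesis .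
  qed
  have Km: "(\<lambda>(x,t). K x t) \<in> borel_measurable (halfline \<Otimes>\<^sub>M halfline)" unfolding K_def by measurable
  have Kb: "cmod (K x t) \<le> exp (- \<bar>x - t\<bar>)" for x t by (auto simp: K_def)
  have S: "square_integrable (\<lambda>x. LINT t|halfline. K x t * rep_L2 g t)"
    and N: "norm (abs_L2 (\<lambda>x. LINT t|halfline. K x t * rep_L2 g t)) \<le> 2 * norm g"
    using exp_kernel_operator_bounded[OF Km Kb, of g] by auto
  let ?G = "\<lambda>x. LINT t|halfline. K x t * rep_L2 g t"
  have "primitive_of (abs_L2 ?G) (1 *\<^sub>R abs_L2 ?G + g) c"
  proof (rule primitive_of_abs_L2[OF S])
    fix x :: real assume x: "0 < x"
    have "F x = c + integral_from_0 (\<lambda>t. of_real 1 * F t + rep_L2 g t) x"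
      unfolding F_def h_def by (rule variation_of_constants[OF loc_integrable_rep x])
    also have "integral_from_0 (\<lambda>t. of_real 1 * F t + rep_L2 g t) x = integral_from_0 (\<lambda>t. of_real 1 * ?G t + rep_L2 g t) x"
      by (intro integral_from_0_cong) (simp add: FK)
    finally show "?G x = c + integral_from_0 (\<lambda>t. of_real 1 * ?G t + rep_L2 g t) x" by (simp only: FK[OF x])
  qed
  with N c show ?thesis by auto
qed

lemma square_integrable_exp: "square_integrable (\<lambda>x. exp (complex_of_real (- 1 * x)))"
proof (rule square_integrable_bound(1)[where B = 2])
  have "(\<integral>\<^sup>+x. ennreal ((cmod (exp (complex_of_real (- 1 * x))))\<^sup>2) \<partial>halfline) \<le> (\<integral>\<^sup>+x. ennreal (exp (- \<bar>0 - x\<bar>)) \<partial>halfline)"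
    by (intro nn_integral_mono ennreal_leI) (auto simp: power2_eq_square simp flip: exp_add)
  also have "\<dots> \<le> 2" by (rule nn_integral_exp_kernel) simp
  also have "\<dots> \<le> ennreal (2\<^sup>2)" by simp
  finally show "(\<integral>\<^sup>+x. ennreal ((cmod (exp (complex_of_real (- 1 * x))))\<^sup>2) \<partial>halfline) \<le> ennreal (2\<^sup>2)" .
qed auto

text \<open>Here the homogeneous solution $e^{-x}$ is square integrable, so the initial value is free. The
  particular solution is $\int_0^x e^{t-x} g(t)\,dt$.\<close>

lemma ode_solution_minus:
  "\<exists>y. primitive_of y (g - y) c \<and> norm y \<le> norm (abs_L2 (\<lambda>x. exp (complex_of_real (- 1 * x)))) * cmod c + 2 * norm g"
proof -
  let ?e = "\<lambda>x. exp (complex_of_real (- 1 * x))"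
  define K where "K = (\<lambda>x t. if t \<le> x then exp (complex_of_real (t - x)) else 0)"
  have Km: "(\<lambda>(x,t). K x t) \<in> borel_measurable (halfline \<Otimes>\<^sub>M halfline)" unfolding K_def by measurable
  have Kb: "cmod (K x t) \<le> exp (- \<bar>x - t\<bar>)" for x t by (auto simp: K_def)
  let ?G = "\<lambda>x. LINT t|halfline. K x t * rep_L2 g t"
  have S: "square_integrable ?G" and N: "norm (abs_L2 ?G) \<le> 2 * norm g"
    using exp_kernel_operator_bounded[OF Km Kb, of g] by auto
  define F where "F = (\<lambda>x. c * ?e x + ?G x)"
  have SF: "square_integrable F"
    unfolding F_def by (intro square_integrable_add square_integrable_cmult square_integrable_exp S)
  have FK: "F x = exp (complex_of_real (- 1 * x)) * (c + integral_from_0 (\<lambda>t. exp (complex_of_real (- (- 1) * t)) * rep_L2 g t) x)" for x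
  proof -
    have "?e x * integral_from_0 (\<lambda>t. exp (complex_of_real (- (- 1) * t)) * rep_L2 g t) x = ?G x"
      unfolding integral_from_0_def integral_mult_right_zero[symmetric]
      by (intro Bochner_Integration.integral_cong)
        (auto simp: K_def indicator_def exp_diff exp_minus divide_inverse)
    then show ?thesis by (simp add: F_def distrib_left mult.commute)
  qed
  have "primitive_of (abs_L2 F) ((- 1) *\<^sub>R abs_L2 F + g) c"
  proof (rule primitive_of_abs_L2[OF SF])
    fix x :: real assume x: "0 < x"
    show "F x = c + integral_from_0 (\<lambda>t. of_real (- 1) * F t + rep_L2 g t) x"
      unfolding FK by (rule variation_of_constants[OF loc_integrable_rep x])
  qed
  moreover have "norm (abs_L2 F) \<le> norm (abs_L2 ?e) * cmod c + 2 * norm g"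
  proof -
    have "abs_L2 F = c *\<^sub>C abs_L2 ?e + abs_L2 ?G"
    proof (rule L2_eqI)
      show "AE x in halfline. rep_L2 (abs_L2 F) x = rep_L2 (c *\<^sub>C abs_L2 ?e + abs_L2 ?G) x"
        using rep_abs_L2[OF SF] rep_abs_L2[OF S] rep_abs_L2[OF square_integrable_exp]
          rep_add[of "c *\<^sub>C abs_L2 ?e" "abs_L2 ?G"] rep_scaleC[of c "abs_L2 ?e"]
        by eventually_elim (simp add: F_def)
    qed
    then have "norm (abs_L2 F) \<le> norm (c *\<^sub>C abs_L2 ?e) + norm (abs_L2 ?G)" by (simp add: norm_triangle_ineq)
    with N show ?thesis by (simp add: norm_scaleC mult.commute)
  qed
  ultimately show ?thesis by (intro exI[of _ "abs_L2 F"]) auto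
qed

text \<open>By the product rule, $e^{-sx} y$ has derivative zero and therefore equals its initial value.\<close>

lemma ode_homogeneous:
  assumes "primitive_of y (s *\<^sub>R y) c"
  shows "AE x in halfline. rep_L2 y x = c * exp (complex_of_real (s * x))"
proof -
  let ?f = "\<lambda>t. of_real (- s) * exp (complex_of_real (- s * t))"
  define Y where "Y = (\<lambda>x. c + integral_from_0 (rep_L2 (s *\<^sub>R y)) x)"
  have Y: "AE x in halfline. rep_L2 y x = Y x" using assms by (simp add: primitive_of_def Y_def)
  have e: "exp (complex_of_real (- s * x)) = 1 + integral_from_0 ?f x" if "0 < x" for x
    using that by (rule exp_eq_integral_from_0)
  have lf: "loc_integrable ?f" by (intro loc_integrable_cont continuous_intros)
  have cY: "continuous_on UNIV Y" unfolding Y_def by (intro continuous_intros continuous_integral_from_0) simp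
  note [measurable] = measurable_halfline_cont[OF cY]
  have "Y x = c * exp (complex_of_real (s * x))" if x: "0 < x" for x
  proof -
    have "Y x * exp (complex_of_real (- s * x)) = c * 1 + integral_from_0 (\<lambda>t. rep_L2 (s *\<^sub>R y) t * exp (complex_of_real (- s * t)) + Y t * ?f t) x"
      by (rule product_rule[OF loc_integrable_rep lf _ e x]) (simp_all add: Y_def)
    also have "integral_from_0 (\<lambda>t. rep_L2 (s *\<^sub>R y) t * exp (complex_of_real (- s * t)) + Y t * ?f t) x = integral_from_0 (\<lambda>t. 0) x"
    proof (rule integral_from_0_cong_AE)
      show "AE t in halfline. rep_L2 (s *\<^sub>R y) t * exp (complex_of_real (- s * t)) + Y t * ?f t = 0"
        using Y rep_scaleR[of s y] by eventually_elim (simp add: algebra_simps)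
    qed measurable
    also have "\<dots> = 0" by (simp add: integral_from_0_def)
    finally show ?thesis by (simp add: exp_minus field_simps)
  qed
  then show ?thesis using Y AE_space by (auto elim!: eventually_elim2)
qed

text \<open>A nonzero multiple of $e^x$ is bounded away from zero, hence not square integrable.\<close>

lemma ode_homogeneous_plus:
  assumes "primitive_of y y c" shows "c = 0 \<and> y = 0"
proof -
  have y: "AE x in halfline. rep_L2 y x = c * exp (complex_of_real (1 * x))"
    by (rule ode_homogeneous) (use assms in simp)
  have c: "c = 0"
  proof (rule ccontr)
    assume "c \<noteq> 0"
    have "integrable halfline (\<lambda>x. (1::real))"
    proof (rule Bochner_Integration.integrable_bound)
      show "integrable halfline (\<lambda>x. (1 / (cmod c)\<^sup>2) * (cmod (rep_L2 y x))\<^sup>2)"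
        by (intro integrable_mult_right integrable_rep)
      show "AE x in halfline. norm (1::real) \<le> norm ((1 / (cmod c)\<^sup>2) * (cmod (rep_L2 y x))\<^sup>2)"
        using y AE_space
      proof eventually_elim
        case (elim x)
        then show ?case using \<open>c \<noteq> 0\<close> by (simp add: norm_mult power_mult_distrib)
      qed
    qed simp
    then have "emeasure halfline (space halfline) < \<infinity>" by (simp add: integrable_iff_bounded)
    then have "emeasure lborel {0::real<..} < \<infinity>"
      unfolding space_halfline by (simp add: halfline_def emeasure_restrict_space)
    then obtain n where "emeasure lborel {0::real<..} < of_nat n" using ennreal_Ex_less_of_nat by auto
    moreover have "emeasure lborel {0<..real n} \<le> emeasure lborel {0::real<..}" by (intro emeasure_mono) auto
    ultimately show False by (simp add: ennreal_of_nat_eq_real_of_nat)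
  qed
  have "y = 0" using y rep_zero by (intro L2_eqI) (auto simp: c elim!: eventually_elim2)
  with c show ?thesis by simp
qed

lemma ode_homogeneous_minus:
  assumes "primitive_of y (- y) 0" shows "y = 0"
proof -
  have "AE x in halfline. rep_L2 y x = 0 * exp (complex_of_real (-1 * x))"
    by (rule ode_homogeneous) (use assms in simp)
  then show ?thesis using rep_zero by (intro L2_eqI) (auto elim!: eventually_elim2)
qed


section \<open>The Robin problem as a first-order system\<close>

interpretation cvec: vector_space "scaleC :: complex \<Rightarrow> 'a \<Rightarrow> 'a::complex_normed_vector"
proof
  fix x :: 'a show "1 *\<^sub>C x = x" using scaleC_of_real[of 1 x] by simp
qed (auto simp: scaleC_add_right scaleC_add_left scaleC_scaleC)

lemma scaleR_scaleC: "r *\<^sub>R x = complex_of_real r *\<^sub>C x"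
  by (simp add: scaleC_of_real)

text \<open>The equations $-v'/(2m) - zu = f$ and $u' - v = h$ with $v(0) = \beta u(0)$, solved for the derivatives.
  The inhomogeneity \<open>h\<close> has no counterpart in the second-order problem; it carries $g/c$ and
  the feedback $\varepsilon v$ of the second Dirac equation.\<close>

definition robin_system :: "real \<Rightarrow> real \<Rightarrow> complex \<Rightarrow> L2 \<Rightarrow> L2 \<Rightarrow> L2 \<Rightarrow> L2 \<Rightarrow> bool" where
  "robin_system m \<beta> z u v f h \<longleftrightarrow>
     (\<exists>a. primitive_of u (v + h) a \<and> primitive_of v ((- 2 * m) *\<^sub>R (f + z *\<^sub>C u)) (of_real \<beta> * a))"

lemma robin_system_add:
  assumes "robin_system m \<beta> z u v f h" "robin_system m \<beta> z u' v' f' h'"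
  shows "robin_system m \<beta> z (u + u') (v + v') (f + f') (h + h')"
proof -
  from assms obtain a a' where
    a: "primitive_of u (v + h) a" "primitive_of v ((- 2 * m) *\<^sub>R (f + z *\<^sub>C u)) (of_real \<beta> * a)"
    "primitive_of u' (v' + h') a'" "primitive_of v' ((- 2 * m) *\<^sub>R (f' + z *\<^sub>C u')) (of_real \<beta> * a')"
    unfolding robin_system_def by blast
  have "primitive_of (u + u') ((v + v') + (h + h')) (a + a')"
    using primitive_of_add[OF a(1,3)] by (simp add: add_ac)
  moreover have "primitive_of (v + v') ((- 2 * m) *\<^sub>R (f + f' + z *\<^sub>C (u + u'))) (of_real \<beta> * (a + a'))"
  proof -
    have "(- 2 * m) *\<^sub>R (f + f' + z *\<^sub>C (u + u')) = (- 2 * m) *\<^sub>R (f + z *\<^sub>C u) + (- 2 * m) *\<^sub>R (f' + z *\<^sub>C u')"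
      by (simp add: scaleC_add_right algebra_simps)
    with primitive_of_add[OF a(2,4)] show ?thesis by (simp only: distrib_left)
  qed
  ultimately show ?thesis unfolding robin_system_def by blast
qed

lemma robin_system_scaleR:
  assumes "robin_system m \<beta> z u v f h"
  shows "robin_system m \<beta> z (r *\<^sub>R u) (r *\<^sub>R v) (r *\<^sub>R f) (r *\<^sub>R h)"
proof -
  from assms obtain a where
    a: "primitive_of u (v + h) a" "primitive_of v ((- 2 * m) *\<^sub>R (f + z *\<^sub>C u)) (of_real \<beta> * a)"
    unfolding robin_system_def by blast
  have "z *\<^sub>C r *\<^sub>R u = r *\<^sub>R (z *\<^sub>C u)" by (simp add: scaleR_scaleC mult.commute)
  then have "primitive_of (r *\<^sub>R v) ((- 2 * m) *\<^sub>R (r *\<^sub>R f + z *\<^sub>C r *\<^sub>R u)) (of_real \<beta> * (r * a))"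
    using primitive_of_scaleR[OF a(2), of r] by (simp add: mult_ac flip: scaleR_add_right)
  moreover have "primitive_of (r *\<^sub>R u) (r *\<^sub>R v + r *\<^sub>R h) (r * a)"
    using primitive_of_scaleR[OF a(1), of r] by (simp add: scaleR_add_right)
  ultimately show ?thesis unfolding robin_system_def by blast
qed

lemma robin_system_diff:
  assumes "robin_system m \<beta> z u v f h" "robin_system m \<beta> z u' v' f' h'"
  shows "robin_system m \<beta> z (u - u') (v - v') (f - f') (h - h')"
  using robin_system_add[OF assms(1) robin_system_scaleR[OF assms(2), of "-1"]] by simp

text \<open>Changing the spectral parameter only moves a multiple of \<open>u\<close> into the first component of the data.\<close>

lemma robin_system_shift:
  assumes "robin_system m \<beta> z u v f h"
  shows "robin_system m \<beta> z' u v (f + (z - z') *\<^sub>C u) h"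
proof -
  have "f + (z - z') *\<^sub>C u + z' *\<^sub>C u = f + z *\<^sub>C u" by (simp add: cvec.scale_left_diff_distrib)
  with assms show ?thesis unfolding robin_system_def by (simp only:)
qed

text \<open>At $z_0 = -1/(2m)$ the system reads $u' = v + h$, $v' = u - F$ with $F = 2mf$, so $p = u + v$ and
  $q = u - v$ decouple: $p' = p + (h - F)$ and $q' = -q + (h + F)$. The first equation fixes $p(0)$, and
  the boundary condition becomes $q(0) = r\,p(0)$ with $r = (1-\beta)/(1+\beta)$, which the free initial
  value of \<open>q\<close> accommodates.\<close>

lemma robin_system_base_solvable:
  assumes m: "0 < m" and \<beta>: "0 < \<beta>"
  shows "\<exists>K\<ge>0. \<forall>f h. \<exists>u v. robin_system m \<beta> (of_real (- 1 / (2 * m))) u v f h \<and> norm u + norm v \<le> K * (norm f + norm h)"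
proof -
  define E where "E = norm (abs_L2 (\<lambda>x. exp (complex_of_real (- 1 * x))))"
  define r where "r = (1 - \<beta>) / (1 + \<beta>)"
  define K where "K = (4 + E * \<bar>r\<bar> * 2) * (1 + 2 * m)"
  have E: "0 \<le> E" by (simp add: E_def)
  show ?thesis
  proof (intro exI[of _ K] conjI allI)
    show "0 \<le> K" unfolding K_def using E m by simp
    fix f h :: L2
    define F where "F = (2 * m) *\<^sub>R f"
    define L where "L = (1 + 2 * m) * (norm f + norm h)"
    have L: "norm h + norm F \<le> L" using m by (simp add: L_def F_def algebra_simps)
    obtain p p0 where p: "primitive_of p (p + (h - F)) p0" "norm p \<le> 2 * norm (h - F)" "cmod p0 \<le> 2 * norm (h - F)"
      using ode_solution_plus by blast
    obtain q where q: "primitive_of q ((h + F) - q) (of_real r * p0)" "norm q \<le> E * cmod (of_real r * p0) + 2 * norm (h + F)"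
      using ode_solution_minus unfolding E_def by blast
    have hF: "norm (h - F) \<le> L" "norm (h + F) \<le> L"
      using L norm_triangle_ineq4[of h F] norm_triangle_ineq[of h F] by auto
    define u where "u = (1/2) *\<^sub>R (p + q)"
    define v where "v = (1/2) *\<^sub>R (p - q)"
    have half: "(1/2) *\<^sub>R (x + x) = x" for x :: L2 by (simp flip: scaleR_2)
    have 1: "(1/2) *\<^sub>R (p + (h - F) + ((h + F) - q)) = v + h"
    proof -
      have "p + (h - F) + ((h + F) - q) = (p - q) + (h + h)" by simp
      then show ?thesis by (simp only: v_def scaleR_add_right[of "1/2" "p - q"] half)
    qed
    have 2: "(1/2) *\<^sub>R (p + (h - F) - ((h + F) - q)) = u - F"
    proof -
      have "p + (h - F) - ((h + F) - q) = (p + q) - (F + F)" by simp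
      then show ?thesis by (simp only: u_def scaleR_diff_right[of "1/2" "p + q"] half)
    qed
    have 3: "(- 2 * m) *\<^sub>R (f + of_real (- 1 / (2 * m)) *\<^sub>C u) = u - F"
      using m by (simp add: F_def scaleC_of_real scaleR_right_diff_distrib del: of_real_minus of_real_divide of_real_mult)
    define a where "a = of_real (1/2) * (p0 + of_real r * p0)"
    have r: "\<beta> * (1 + r) = 1 - r" using \<beta> by (simp add: r_def field_simps)
    have "of_real \<beta> * a = of_real (1/2) * (of_real (\<beta> * (1 + r)) * p0)" by (simp add: a_def algebra_simps)
    then have b: "of_real \<beta> * a = of_real (1/2) * (p0 - of_real r * p0)" unfolding r by (simp add: algebra_simps)
    have "primitive_of u (v + h) a"
      using primitive_of_scaleR[OF primitive_of_add[OF p(1) q(1)], of "1/2"] unfolding 1 u_def[symmetric] a_def[symmetric] .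
    moreover have "primitive_of v (u - F) (of_real \<beta> * a)"
      using primitive_of_scaleR[OF primitive_of_diff[OF p(1) q(1)], of "1/2"] unfolding 2 v_def[symmetric] b .
    ultimately have "robin_system m \<beta> (of_real (- 1 / (2 * m))) u v f h"
      unfolding robin_system_def 3 by blast
    moreover have "norm u + norm v \<le> K * (norm f + norm h)"
    proof -
      have uv: "norm u \<le> (norm p + norm q) / 2" "norm v \<le> (norm p + norm q) / 2"
        unfolding u_def v_def using norm_triangle_ineq[of p q] norm_triangle_ineq4[of p q] by auto
      have pL: "norm p \<le> 2 * L" using p(2) hF by simp
      define B where "B = E * (\<bar>r\<bar> * (2 * L))"
      have qL: "norm q \<le> B + 2 * L"
      proof -
        have "cmod (of_real r * p0) \<le> \<bar>r\<bar> * (2 * L)"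
          unfolding norm_mult norm_of_real using p(3) hF by (intro mult_left_mono) auto
        then have "E * cmod (of_real r * p0) \<le> B" unfolding B_def using E by (rule mult_left_mono)
        then show ?thesis using q(2) hF by linarith
      qed
      have "norm u + norm v \<le> (norm p + norm q) / 2 + (norm p + norm q) / 2" by (intro add_mono uv)
      also have "\<dots> = norm p + norm q" by (rule field_sum_of_halves)
      also have "\<dots> \<le> 2 * L + (B + 2 * L)" by (intro add_mono pL qL)
      also have "\<dots> = K * (norm f + norm h)" by (simp add: B_def K_def L_def algebra_simps)
      finally show ?thesis .
    qed
    ultimately show "\<exists>u v. robin_system m \<beta> (of_real (- 1 / (2 * m))) u v f h \<and> norm u + norm v \<le> K * (norm f + norm h)"
      by blast
  qed
qed

text \<open>In the homogeneous system $p = u + v$ solves $p' = p$, so $p = 0$ and $(1 + \beta)u(0) = 0$. Then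
  $q = u - v$ solves $q' = -q$ with $q(0) = 0$.\<close>

lemma robin_system_base_unique:
  assumes m: "0 < m" and \<beta>: "0 < \<beta>" and s: "robin_system m \<beta> (of_real (- 1 / (2 * m))) u v 0 0"
  shows "u = 0 \<and> v = 0"
proof -
  from s obtain a where a: "primitive_of u (v + 0) a"
     "primitive_of v ((- 2 * m) *\<^sub>R (0 + of_real (- 1 / (2 * m)) *\<^sub>C u)) (of_real \<beta> * a)"
    unfolding robin_system_def by blast
  have "(- 2 * m) *\<^sub>R (0 + of_real (- 1 / (2 * m)) *\<^sub>C u) = u"
    using m by (simp add: scaleC_of_real del: of_real_minus of_real_divide of_real_mult)
  with a have u: "primitive_of u v a" and v: "primitive_of v u (of_real \<beta> * a)" by auto
  have "primitive_of (u + v) (u + v) (a + of_real \<beta> * a)" using primitive_of_add[OF u v] by (simp add: add.commute)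
  from ode_homogeneous_plus[OF this] have p: "u + v = 0" and "(1 + of_real \<beta>) * a = 0" by (auto simp: algebra_simps)
  moreover have "(1 + complex_of_real \<beta>) \<noteq> 0" using \<beta>
    by (metis add_pos_pos less_irrefl of_real_1 of_real_add of_real_eq_0_iff zero_less_one)
  ultimately have "a = 0" by simp
  with primitive_of_diff[OF u v] have "primitive_of (u - v) (- (u - v)) 0" by simp
  from ode_homogeneous_minus[OF this] p have "u = v" "2 *\<^sub>R u = 0" by (auto simp: scaleR_2)
  then show ?thesis by simp
qed

text \<open>With $h = 0$ the second equation says $v = u'$, and the first becomes the resolvent equation.\<close>

lemma robin_laplacian_iff_robin_system:
  assumes m: "0 < m"
  shows "u \<in> op_dom (robin_laplacian m \<beta>) \<and> op_apply (minus_scalar (robin_laplacian m \<beta>) z) u = f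
    \<longleftrightarrow> (\<exists>v. robin_system m \<beta> z u v f 0)"
proof -
  have e: "- ((1 / (2 * m)) *\<^sub>R e) - z *\<^sub>C u = f \<longleftrightarrow> e = (- 2 * m) *\<^sub>R (f + z *\<^sub>C u)" for e
  proof -
    have "- ((1 / (2 * m)) *\<^sub>R e) - z *\<^sub>C u = f \<longleftrightarrow> (- 1 / (2 * m)) *\<^sub>R e = f + z *\<^sub>C u"
      by (auto simp: algebra_simps)
    also have "\<dots> \<longleftrightarrow> (- 2 * m) *\<^sub>R ((- 1 / (2 * m)) *\<^sub>R e) = (- 2 * m) *\<^sub>R (f + z *\<^sub>C u)"
      using m by (simp only: scaleR_cancel_left) simp
    also have "(- 2 * m) *\<^sub>R ((- 1 / (2 * m)) *\<^sub>R e) = e" using m by simp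
    finally show ?thesis .
  qed
  have dom: "u \<in> op_dom (robin_laplacian m \<beta>) \<longleftrightarrow>
      u \<in> H1 \<and> weak_deriv u \<in> H1 \<and> value_at_0 (weak_deriv u) = of_real \<beta> * value_at_0 u"
    by (simp add: robin_laplacian_def H2_def)
  have app: "op_apply (minus_scalar (robin_laplacian m \<beta>) z) u = f \<longleftrightarrow>
      weak_deriv (weak_deriv u) = (- 2 * m) *\<^sub>R (f + z *\<^sub>C u)"
    unfolding robin_laplacian_def minus_scalar_def unbounded_op.sel by (rule e)
  show ?thesis
    unfolding dom app robin_system_def primitive_of_iff by auto
qed

lemma resolvent_eqI:
  assumes "z \<in> resolvent_set A" "x \<in> op_dom A" "op_apply (minus_scalar A z) x = y"
  shows "resolvent A z y = x"
  using assms unfolding resolvent_set_def resolvent_def bij_betw_def by (auto intro: inv_into_f_f)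

lemma resolvent_solves:
  assumes "z \<in> resolvent_set A"
  shows "resolvent A z y \<in> op_dom A \<and> op_apply (minus_scalar A z) (resolvent A z y) = y"
  using assms unfolding resolvent_set_def resolvent_def bij_betw_def
  by (auto intro: inv_into_into f_inv_into_f)

lemma robin_system_zero: "robin_system m \<beta> z 0 0 0 0"
proof -
  have "integral_from_0 (rep_L2 0) x = integral_from_0 (\<lambda>_. 0) x" for x by (rule integral_from_0_cong_AE) (auto simp: rep_zero)
  then have "primitive_of 0 0 0" using rep_zero by (simp add: primitive_of_def integral_from_0_def[of "\<lambda>_. 0"])
  then show ?thesis unfolding robin_system_def by (intro exI[of _ 0]) simp
qed

lemma robin_system_unique:
  assumes m: "0 < m" and z: "z \<in> resolvent_set (robin_laplacian m \<beta>)"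
    and s: "robin_system m \<beta> z u v f h" "robin_system m \<beta> z u' v' f h"
  shows "u = u' \<and> v = v'"
proof -
  have d: "robin_system m \<beta> z (u - u') (v - v') 0 0" using robin_system_diff[OF s] by simp
  have "u - u' = resolvent (robin_laplacian m \<beta>) z 0"
    using resolvent_eqI[OF z] robin_laplacian_iff_robin_system[OF m] d by metis
  also have "\<dots> = 0" using resolvent_eqI[OF z] robin_laplacian_iff_robin_system[OF m] robin_system_zero by metis
  finally have u: "u - u' = 0" .
  with d robin_system_zero[of m \<beta> z] have "v - v' = 0"
    unfolding robin_system_def by (metis add.right_neutral weak_deriv_eq)
  with u show ?thesis by simp
qed

text \<open>Let $(u, v)$ solve the system at $z_0$ with data $(f, h)$. At $z$ it has data
  $(f - g, h)$ with $g = (z - z_0)u$. Adding the solution $((S_0-z)^{-1}g, ((S_0-z)^{-1}g)')$ for $(g, 0)$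
  repairs this. The derivative is bounded because this correction in turn solves the system at $z_0$, where
  all solutions obey the estimate with constant \<open>K\<close>.\<close>

lemma robin_system_solution_operator:
  assumes m: "0 < m" and \<beta>: "0 < \<beta>" and z: "z \<in> resolvent_set (robin_laplacian m \<beta>)"
  shows "\<exists>W N. 0 < N \<and> bounded_linear W \<and> (\<forall>y. norm (W y) \<le> N * norm y) \<and>
    (\<forall>w y. robin_system m \<beta> z (fst w) (snd w) (fst y) (snd y) \<longleftrightarrow> w = W y) \<and>
    (\<forall>f. fst (W (f, 0)) = resolvent (robin_laplacian m \<beta>) z f)"
proof -
  let ?R = "resolvent (robin_laplacian m \<beta>) z"
  let ?z0 = "complex_of_real (- 1 / (2 * m))"
  obtain K where K: "0 \<le> K" "\<And>f h. \<exists>u v. robin_system m \<beta> ?z0 u v f h \<and> norm u + norm v \<le> K * (norm f + norm h)"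
    using robin_system_base_solvable[OF m \<beta>] by blast
  have Kb: "norm u + norm v \<le> K * (norm f + norm h)" if "robin_system m \<beta> ?z0 u v f h" for u v f h
  proof -
    obtain u' v' where *: "robin_system m \<beta> ?z0 u' v' f h" "norm u' + norm v' \<le> K * (norm f + norm h)"
      using K(2) by blast
    have "robin_system m \<beta> ?z0 (u - u') (v - v') 0 0" using robin_system_diff[OF that *(1)] by simp
    from robin_system_base_unique[OF m \<beta> this] * show ?thesis by simp
  qed
  have "bounded_linear ?R" using z by (simp add: resolvent_set_def)
  then obtain C where C: "0 < C" "\<And>f. norm (?R f) \<le> norm f * C" using bounded_linear.pos_bounded by blast
  define d where "d = cmod (z - ?z0)"
  define N where "N = 1 + 2 * (K + K * (d * (K + C * (d * K))))"
  have d: "0 \<le> d" by (simp add: d_def)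
  have ex: "\<exists>u v. robin_system m \<beta> z u v f h \<and> norm u + norm v \<le> (K + K * (d * (K + C * (d * K)))) * (norm f + norm h)" for f h
  proof -
    let ?n = "norm f + norm h"
    obtain u v where uv: "robin_system m \<beta> ?z0 u v f h" "norm u + norm v \<le> K * ?n" using K(2) by blast
    define g where "g = (z - ?z0) *\<^sub>C u"
    obtain b where b: "robin_system m \<beta> z (?R g) b g 0"
      using resolvent_solves[OF z, of g] robin_laplacian_iff_robin_system[OF m] by blast
    have "robin_system m \<beta> z u v (f + (?z0 - z) *\<^sub>C u) h" by (rule robin_system_shift[OF uv(1)])
    from robin_system_add[OF this b]
    have "robin_system m \<beta> z (u + ?R g) (v + b) (f + (?z0 - z) *\<^sub>C u + g) h" by (simp only: add_0_right)
    moreover have "f + (?z0 - z) *\<^sub>C u + g = f"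
      unfolding g_def by (simp only: add.assoc flip: scaleC_add_left) simp
    ultimately have s: "robin_system m \<beta> z (u + ?R g) (v + b) f h" by (simp only:)
    have "norm (?R g) + norm b \<le> K * (norm (g + (z - ?z0) *\<^sub>C ?R g) + norm (0 :: L2))"
      by (rule Kb[OF robin_system_shift[OF b]])
    also have "g + (z - ?z0) *\<^sub>C ?R g = (z - ?z0) *\<^sub>C (u + ?R g)" by (simp add: g_def scaleC_add_right)
    also have "norm \<dots> + norm (0 :: L2) = d * norm (u + ?R g)" by (simp add: norm_scaleC d_def)
    also have "norm (u + ?R g) \<le> K * ?n + C * (d * (K * ?n))"
    proof -
      have u: "norm u \<le> K * ?n" using uv(2) norm_ge_zero[of v] by linarith
      have "norm (?R g) \<le> C * norm g" using C(2)[of g] by (simp add: mult.commute)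
      also have "norm g = d * norm u" by (simp add: g_def norm_scaleC d_def)
      also have "C * (d * norm u) \<le> C * (d * (K * ?n))" using u C(1) d by (intro mult_left_mono) auto
      finally show ?thesis using u norm_triangle_ineq[of u "?R g"] by linarith
    qed
    finally have "norm (?R g) + norm b \<le> K * (d * (K * ?n + C * (d * (K * ?n))))"
      using K(1) d by (simp add: mult_left_mono)
    with uv(2) norm_triangle_ineq[of u "?R g"] norm_triangle_ineq[of v b]
    have "norm (u + ?R g) + norm (v + b) \<le> K * ?n + K * (d * (K * ?n + C * (d * (K * ?n))))" by linarith
    also have "\<dots> = (K + K * (d * (K + C * (d * K)))) * ?n" by (simp add: algebra_simps)
    finally show ?thesis using s by blast
  qed
  have "\<exists>w. robin_system m \<beta> z (fst w) (snd w) (fst y) (snd y) \<and> norm w \<le> N * norm y" for y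
  proof -
    let ?c = "K + K * (d * (K + C * (d * K)))"
    have c: "0 \<le> ?c" using K(1) d C(1) by simp
    obtain u v where uv: "robin_system m \<beta> z u v (fst y) (snd y)" "norm u + norm v \<le> ?c * (norm (fst y) + norm (snd y))"
      using ex by blast
    have "norm (u, v) \<le> norm u + norm v" by (rule norm_Pair_le)
    also have "\<dots> \<le> ?c * (norm y + norm y)"
      using uv(2) c norm_fst_le[of "fst y" "snd y"] norm_snd_le[of "snd y" "fst y"]
      by (elim order_trans) (intro mult_left_mono add_mono, auto)
    also have "\<dots> \<le> N * norm y" by (simp add: N_def algebra_simps)
    finally show ?thesis using uv(1) by (intro exI[of _ "(u, v)"]) simp
  qed
  then have "\<forall>y. \<exists>w. robin_system m \<beta> z (fst w) (snd w) (fst y) (snd y) \<and> norm w \<le> N * norm y" by blast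
  from choice[OF this] obtain W where W: "\<And>y. robin_system m \<beta> z (fst (W y)) (snd (W y)) (fst y) (snd y)"
    "\<And>y. norm (W y) \<le> N * norm y" by blast
  have Wiff: "robin_system m \<beta> z (fst w) (snd w) (fst y) (snd y) \<longleftrightarrow> w = W y" for w y
  proof
    assume "robin_system m \<beta> z (fst w) (snd w) (fst y) (snd y)"
    from robin_system_unique[OF m z this W(1)] show "w = W y" by (simp add: prod_eq_iff)
  qed (use W(1) in blast)
  have "bounded_linear W"
  proof (rule bounded_linear_intro)
    fix x y :: "L2 \<times> L2" and r :: real
    have "W x + W y = W (x + y)" using robin_system_add[OF W(1)[of x] W(1)[of y]] by (simp flip: Wiff)
    then show "W (x + y) = W x + W y" by simp
    have "r *\<^sub>R W x = W (r *\<^sub>R x)" using robin_system_scaleR[OF W(1)[of x], of r] by (simp flip: Wiff)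
    then show "W (r *\<^sub>R x) = r *\<^sub>R W x" by simp
    show "norm (W x) \<le> norm x * N" using W(2)[of x] by (simp add: mult.commute)
  qed
  moreover have "fst (W (f, 0)) = ?R f" for f
  proof -
    have "robin_system m \<beta> z (fst (W (f, 0))) (snd (W (f, 0))) f 0" using W(1)[of "(f, 0)"] by simp
    then show ?thesis using resolvent_eqI[OF z] robin_laplacian_iff_robin_system[OF m] by metis
  qed
  moreover have "0 < N" using K(1) d C(1) by (simp add: N_def add_pos_nonneg)
  ultimately show ?thesis using W(2) Wiff by blast
qed


section \<open>The Dirac operator as a perturbation of the Robin system\<close>

lemma norm_fst_le_norm: "norm (fst x) \<le> norm x" and norm_snd_le_norm: "norm (snd x) \<le> norm x"
  for x :: "'a::real_normed_vector \<times> 'b::real_normed_vector"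
  using norm_fst_le[of "fst x" "snd x"] norm_snd_le[of "snd x" "fst x"] by simp_all

text \<open>The right-hand side is a contraction of ratio 1/2 in \<open>w\<close>.\<close>

lemma fixed_point_of_small_perturbation:
  fixes W P :: "'a::banach \<Rightarrow> 'a"
  assumes W: "bounded_linear W" "\<And>y. norm (W y) \<le> N * norm y" and P: "\<And>w w'. P (w - w') = P w - P w'"
    and Pb: "\<And>w. norm (P w) \<le> d * norm w" and N: "0 < N" "N * d \<le> 1 / 2"
  shows "\<exists>w. w = W (y + P w)"
    and "w = W (y + P w) \<Longrightarrow> w' = W (y + P w') \<Longrightarrow> w = w'"
    and "w = W (y + P w) \<Longrightarrow> norm w \<le> 2 * N * norm y"
proof -
  interpret W: bounded_linear W by fact
  have NP: "norm (W (P w)) \<le> 1 / 2 * norm w" for w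
  proof -
    have "norm (W (P w)) \<le> N * (d * norm w)"
      using W(2)[of "P w"] Pb[of w] N(1) by (meson mult_left_mono less_imp_le order_trans)
    also have "\<dots> = (N * d) * norm w" by simp
    also have "\<dots> \<le> 1 / 2 * norm w" using N(2) by (intro mult_right_mono) auto
    finally show ?thesis .
  qed
  have lip: "dist (W (y + P w)) (W (y + P w')) \<le> 1 / 2 * dist w w'" for w w'
  proof -
    have "W (y + P w) - W (y + P w') = W (P (w - w'))" by (simp add: P flip: W.diff)
    then show ?thesis using NP[of "w - w'"] by (simp add: dist_norm)
  qed
  have "\<exists>!w. W (y + P w) = w"
    by (rule banach_fix_type[where c = "1 / 2"], simp, simp, intro allI lip)
  then obtain w0 where "W (y + P w0) = w0" by (rule ex1E)
  then show "\<exists>w. w = W (y + P w)" by (intro exI[of _ w0]) (rule sym)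
  show "w = w'" if "w = W (y + P w)" "w' = W (y + P w')"
  proof -
    have "dist w w' \<le> 1 / 2 * dist w w'"
      using lip[of w w'] by (simp only: flip: that)
    then have "dist w w' \<le> 0" by simp
    then show ?thesis by simp
  qed
  assume "w = W (y + P w)"
  then have "w = W y + W (P w)" by (simp add: W.add)
  then have "norm w \<le> N * norm y + 1 / 2 * norm w"
    using norm_triangle_ineq[of "W y" "W (P w)"] W(2)[of y] NP[of w] by simp
  then show "norm w \<le> 2 * N * norm y" by simp
qed

text \<open>The rescaling $v = 2mc\,\psi_2$ turns the boundary condition $\psi_1(0)\cot(\alpha)/(mc) = \psi_2(0)$ into
  $v(0) = 2\cot(\alpha)\,u(0)$, and moves the whole dependence on \<open>c\<close> into the data.\<close>

lemma dirac_iff_robin_system: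
  fixes m c \<alpha> :: real
  assumes m: "0 < m" and c: "0 < c"
  defines "A \<equiv> minus_scalar (dirac_op m \<alpha> c) (complex_of_real (m * c\<^sup>2))"
  shows "\<psi> \<in> op_dom A \<and> op_apply (minus_scalar A z) \<psi> = y \<longleftrightarrow>
    robin_system m (2 * cot \<alpha>) z (fst \<psi>) ((2 * m * c) *\<^sub>R snd \<psi>) (fst y)
       ((1 / c) *\<^sub>R snd y + (z / of_real (2 * m * c\<^sup>2)) *\<^sub>C ((2 * m * c) *\<^sub>R snd \<psi>))"
proof -
  obtain \<psi>1 \<psi>2 where \<psi>: "\<psi> = (\<psi>1, \<psi>2)" by fastforce
  obtain f g where y: "y = (f, g)" by fastforce
  have dom: "\<psi> \<in> op_dom A \<longleftrightarrow> \<psi>1 \<in> H1 \<and> \<psi>2 \<in> H1 \<and> value_at_0 \<psi>1 * of_real (cot \<alpha> / (m * c)) = value_at_0 \<psi>2"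
    by (simp add: A_def \<psi> minus_scalar_def dirac_op_def)
  have "op_apply (minus_scalar A z) \<psi> =
     (- (c *\<^sub>R weak_deriv \<psi>2) - z *\<^sub>C \<psi>1, c *\<^sub>R weak_deriv \<psi>1 - (2 * m * c\<^sup>2) *\<^sub>R \<psi>2 - z *\<^sub>C \<psi>2)"
  proof -
    have "(2 * m * c\<^sup>2) *\<^sub>R \<psi>2 = (m * c\<^sup>2) *\<^sub>R \<psi>2 + (m * c\<^sup>2) *\<^sub>R \<psi>2" by (simp flip: scaleR_add_left)
    moreover have "complex_of_real (m * c\<^sup>2) *\<^sub>C x = (m * c\<^sup>2) *\<^sub>R x" for x :: L2 by (rule scaleC_of_real)
    ultimately show ?thesis
      unfolding A_def \<psi> minus_scalar_def dirac_op_def scaleC_prod_def unbounded_op.sel by (simp only:) simp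
  qed
  then have app: "op_apply (minus_scalar A z) \<psi> = y \<longleftrightarrow>
     - (c *\<^sub>R weak_deriv \<psi>2) - z *\<^sub>C \<psi>1 = f \<and> c *\<^sub>R weak_deriv \<psi>1 - (2 * m * c\<^sup>2) *\<^sub>R \<psi>2 - z *\<^sub>C \<psi>2 = g"
    by (simp only: y prod.inject)
  have e1: "- (c *\<^sub>R \<phi>2) - z *\<^sub>C \<psi>1 = f \<longleftrightarrow> (2 * m * c) *\<^sub>R \<phi>2 = (- 2 * m) *\<^sub>R (f + z *\<^sub>C \<psi>1)" for \<phi>2
  proof -
    have "- (c *\<^sub>R \<phi>2) - z *\<^sub>C \<psi>1 = f \<longleftrightarrow> - (c *\<^sub>R \<phi>2) = f + z *\<^sub>C \<psi>1" by (auto simp: algebra_simps)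
    also have "\<dots> \<longleftrightarrow> (- 2 * m) *\<^sub>R (- (c *\<^sub>R \<phi>2)) = (- 2 * m) *\<^sub>R (f + z *\<^sub>C \<psi>1)"
      using m by (simp only: scaleR_cancel_left) simp
    also have "(- 2 * m) *\<^sub>R (- (c *\<^sub>R \<phi>2)) = (2 * m * c) *\<^sub>R \<phi>2" by simp
    finally show ?thesis .
  qed
  have e2: "c *\<^sub>R \<phi>1 - (2 * m * c\<^sup>2) *\<^sub>R \<psi>2 - z *\<^sub>C \<psi>2 = g \<longleftrightarrow>
    \<phi>1 = (2 * m * c) *\<^sub>R \<psi>2 + ((1 / c) *\<^sub>R g + (z / of_real (2 * m * c\<^sup>2)) *\<^sub>C ((2 * m * c) *\<^sub>R \<psi>2))" for \<phi>1
  proof -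
    have "c *\<^sub>R \<phi>1 - (2 * m * c\<^sup>2) *\<^sub>R \<psi>2 - z *\<^sub>C \<psi>2 = g \<longleftrightarrow> c *\<^sub>R \<phi>1 = (2 * m * c\<^sup>2) *\<^sub>R \<psi>2 + (g + z *\<^sub>C \<psi>2)"
      by (auto simp: algebra_simps)
    also have "\<dots> \<longleftrightarrow> (1 / c) *\<^sub>R (c *\<^sub>R \<phi>1) = (1 / c) *\<^sub>R ((2 * m * c\<^sup>2) *\<^sub>R \<psi>2 + (g + z *\<^sub>C \<psi>2))"
      using c by (simp only: scaleR_cancel_left) simp
    also have "(1 / c) *\<^sub>R (c *\<^sub>R \<phi>1) = \<phi>1" using c by simp
    also have "(1 / c) *\<^sub>R ((2 * m * c\<^sup>2) *\<^sub>R \<psi>2 + (g + z *\<^sub>C \<psi>2)) = (2 * m * c) *\<^sub>R \<psi>2 + ((1 / c) *\<^sub>R g + (1 / c) *\<^sub>R (z *\<^sub>C \<psi>2))"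
      using c by (simp add: scaleR_add_right power2_eq_square)
    also have "(1 / c) *\<^sub>R (z *\<^sub>C \<psi>2) = (z / of_real (2 * m * c\<^sup>2)) *\<^sub>C ((2 * m * c) *\<^sub>R \<psi>2)"
      using m c by (simp add: scaleR_scaleC power2_eq_square field_simps)
    finally show ?thesis .
  qed
  have val: "a * of_real (cot \<alpha> / (m * c)) = b \<longleftrightarrow> of_real (2 * m * c) * b = of_real (2 * cot \<alpha>) * a" for a b :: complex
  proof -
    have k: "complex_of_real (2 * m * c) \<noteq> 0" using m c by simp
    have "2 * cot \<alpha> = 2 * m * c * (cot \<alpha> / (m * c))" using m c by simp
    then have e: "of_real (2 * cot \<alpha>) * a = of_real (2 * m * c) * (a * of_real (cot \<alpha> / (m * c)))"
      by (simp only: of_real_mult mult_ac)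
    have "x = b \<longleftrightarrow> k * b = k * x" if "k \<noteq> 0" for k x :: complex using that by auto
    from this[OF k] show ?thesis by (simp only: e)
  qed
  have prim2: "primitive_of ((2 * m * c) *\<^sub>R \<psi>2) \<phi> b \<longleftrightarrow> (\<exists>\<phi>2 b'. primitive_of \<psi>2 \<phi>2 b' \<and> (2 * m * c) *\<^sub>R \<phi>2 = \<phi> \<and> of_real (2 * m * c) * b' = b)" for \<phi> b
  proof
    assume p: "primitive_of ((2 * m * c) *\<^sub>R \<psi>2) \<phi> b"
    have "primitive_of \<psi>2 ((1 / (2 * m * c)) *\<^sub>R \<phi>) (of_real (1 / (2 * m * c)) * b)"
      using primitive_of_scaleR[OF p, of "1 / (2 * m * c)"] m c by simp
    then show "\<exists>\<phi>2 b'. primitive_of \<psi>2 \<phi>2 b' \<and> (2 * m * c) *\<^sub>R \<phi>2 = \<phi> \<and> of_real (2 * m * c) * b' = b"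
      using m c by (intro exI[of _ "(1 / (2 * m * c)) *\<^sub>R \<phi>"] exI[of _ "of_real (1 / (2 * m * c)) * b"]) auto
  qed (elim exE conjE, hypsubst, rule primitive_of_scaleR)
  show ?thesis
    unfolding dom app e1[of "weak_deriv \<psi>2"] e2[of "weak_deriv \<psi>1"] val[of "value_at_0 \<psi>1" "value_at_0 \<psi>2"]
    unfolding robin_system_def \<psi> y fst_conv snd_conv
    unfolding prim2
    unfolding primitive_of_iff by blast
qed

text \<open>The bound is a sum of three contributions of orders $1/c$, $1/c^2$ and $1/c$: the datum $g/c$, the
  feedback $\varepsilon v$, and the lower component $\psi_2 = v/(2mc)$ itself. The factor \<open>4 * N\<close> bounds the
  rescaled solution in terms of the data.\<close>

lemma dirac_resolvent_estimate:
  assumes m: "0 < m" and \<beta>: "0 < cot \<alpha>" and z: "z \<in> resolvent_set (robin_laplacian m (2 * cot \<alpha>))"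
  shows "\<exists>N>0. \<forall>c\<ge>1. N * (cmod z / (2 * m * c\<^sup>2)) \<le> 1 / 2 \<longrightarrow>
     z \<in> resolvent_set (minus_scalar (dirac_op m \<alpha> c) (complex_of_real (m * c\<^sup>2))) \<and>
     (\<forall>\<psi>. norm (resolvent (minus_scalar (dirac_op m \<alpha> c) (complex_of_real (m * c\<^sup>2))) z \<psi>
             - (resolvent (robin_laplacian m (2 * cot \<alpha>)) z (fst \<psi>), 0))
       \<le> (N * (1 / c + cmod z / (2 * m * c\<^sup>2) * (4 * N)) + 1 / (2 * m * c) * (4 * N)) * norm \<psi>)"
proof -
  let ?R = "resolvent (robin_laplacian m (2 * cot \<alpha>)) z"
  obtain W N where N: "0 < N" and W: "bounded_linear W" "\<And>y. norm (W y) \<le> N * norm y"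
    and Wiff: "\<And>w y. robin_system m (2 * cot \<alpha>) z (fst w) (snd w) (fst y) (snd y) \<longleftrightarrow> w = W y"
    and WR: "\<And>f. fst (W (f, 0)) = ?R f"
    using robin_system_solution_operator[OF m _ z] \<beta> by auto
  interpret W: bounded_linear W by fact
  show ?thesis
  proof (intro exI[of _ N] conjI allI impI N)
    fix c :: real
    assume c1: "1 \<le> c" and small: "N * (cmod z / (2 * m * c\<^sup>2)) \<le> 1 / 2"
    then have c: "0 < c" by simp
    define A where "A = minus_scalar (dirac_op m \<alpha> c) (complex_of_real (m * c\<^sup>2))"
    define \<epsilon> where "\<epsilon> = z / of_real (2 * m * c\<^sup>2)"
    \<comment> \<open>\<open>Y\<close> rescales the data and \<open>J\<close> the solution; \<open>P\<close> is the feedback of the solution into the data.\<close>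
    define P where "P = (\<lambda>w :: L2 \<times> L2. (0 :: L2, \<epsilon> *\<^sub>C snd w))"
    define Y where "Y = (\<lambda>y :: L2 \<times> L2. (fst y, (1 / c) *\<^sub>R snd y))"
    define J where "J = (\<lambda>\<psi> :: L2 \<times> L2. (fst \<psi>, (2 * m * c) *\<^sub>R snd \<psi>))"
    have \<epsilon>: "cmod \<epsilon> = cmod z / (2 * m * c\<^sup>2)" using m by (simp add: \<epsilon>_def norm_divide norm_mult norm_power)
    have P: "P (w - w') = P w - P w'" for w w' by (simp add: P_def cvec.scale_right_diff_distrib)
    have Pb: "norm (P w) \<le> cmod \<epsilon> * norm w" for w
      using norm_snd_le[of "snd w" "fst w"] by (simp add: P_def norm_scaleC mult_left_mono)
    note pert = fixed_point_of_small_perturbation[OF W P Pb N small[folded \<epsilon>]]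
    have sol: "\<psi> \<in> op_dom A \<and> op_apply (minus_scalar A z) \<psi> = y \<longleftrightarrow> J \<psi> = W (Y y + P (J \<psi>))" for \<psi> y
      unfolding A_def dirac_iff_robin_system[OF m c] Wiff[symmetric] by (simp add: J_def Y_def P_def \<epsilon>_def)
    have Jinj: "J \<psi> = w \<longleftrightarrow> \<psi> = (fst w, (1 / (2 * m * c)) *\<^sub>R snd w)" for \<psi> w
    proof -
      have "(2 * m * c) *\<^sub>R x = y \<longleftrightarrow> x = (1 / (2 * m * c)) *\<^sub>R y" for x y :: L2 using m c by auto
      then show ?thesis by (simp only: J_def prod_eq_iff fst_conv snd_conv)
    qed
    have ex: "\<exists>\<psi>. \<psi> \<in> op_dom A \<and> op_apply (minus_scalar A z) \<psi> = y" for y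
    proof -
      obtain w where w: "w = W (Y y + P w)" using pert(1)[of "Y y"] by (rule exE)
      define \<psi> where "\<psi> = (fst w, (1 / (2 * m * c)) *\<^sub>R snd w)"
      have "J \<psi> = w" unfolding Jinj by (rule \<psi>_def)
      with w have "J \<psi> = W (Y y + P (J \<psi>))" by (simp only:)
      then show ?thesis unfolding sol by (rule exI)
    qed
    have uniq: "\<psi> = \<psi>'" if "\<psi> \<in> op_dom A \<and> op_apply (minus_scalar A z) \<psi> = y"
      "\<psi>' \<in> op_dom A \<and> op_apply (minus_scalar A z) \<psi>' = y" for \<psi> \<psi>' y
    proof -
      have "J \<psi> = J \<psi>'" using that unfolding sol by (rule pert(2))
      then show ?thesis using Jinj[of \<psi> "J \<psi>'"] Jinj[of \<psi>' "J \<psi>'"] by simp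
    qed
    have bij: "bij_betw (op_apply (minus_scalar A z)) (op_dom A) UNIV"
      unfolding bij_betw_def
    proof
      show "inj_on (op_apply (minus_scalar A z)) (op_dom A)" by (intro inj_onI uniq) auto
      have "y \<in> op_apply (minus_scalar A z) ` op_dom A" for y using ex[of y] by auto
      then show "op_apply (minus_scalar A z) ` op_dom A = UNIV" by auto
    qed
    let ?S = "resolvent A z"
    have S: "?S y \<in> op_dom A \<and> op_apply (minus_scalar A z) (?S y) = y" for y
      using bij unfolding resolvent_def bij_betw_def by (auto intro: inv_into_into f_inv_into_f)
    have JS: "J (?S y) = W (Y y + P (J (?S y)))" for y using S[of y] unfolding sol .
    have SJ: "\<psi> = ?S y" if "J \<psi> = W (Y y + P (J \<psi>))" for \<psi> y
      using that[folded sol] S[of y] by (rule uniq)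
    have Jb: "norm (J (?S y)) \<le> 4 * N * norm y" for y
    proof -
      have "norm (J (?S y)) \<le> 2 * N * norm (Y y)" by (rule pert(3)[OF JS])
      also have "norm (Y y) \<le> norm (fst y) + norm ((1 / c) *\<^sub>R snd y)" unfolding Y_def by (rule norm_Pair_le)
      also have "norm ((1 / c) *\<^sub>R snd y) \<le> norm (snd y)"
        using c1 by (simp add: divide_le_eq mult_left_le_one_le mult_le_cancel_left1)
      also have "norm (fst y) + norm (snd y) \<le> norm y + norm y"
        using norm_fst_le[of "fst y" "snd y"] norm_snd_le[of "snd y" "fst y"] by simp
      finally show ?thesis using N by (simp add: mult_left_mono)
    qed
    have est: "norm (?S y - (?R (fst y), 0)) \<le> (N * (1 / c + cmod z / (2 * m * c\<^sup>2) * (4 * N)) + 1 / (2 * m * c) * (4 * N)) * norm y" for y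
    proof -
      let ?w = "J (?S y)"
      have "?S y = (fst ?w, (1 / (2 * m * c)) *\<^sub>R snd ?w)" by (rule Jinj[THEN iffD1]) (rule refl)
      then have eq: "?S y - (?R (fst y), 0) = (fst (?w - W (fst y, 0)), (1 / (2 * m * c)) *\<^sub>R snd ?w)"
        by (simp add: WR prod_eq_iff)
      have "?w - W (fst y, 0) = W (Y y + P ?w) - W (fst y, 0)" by (rule arg_cong2[OF JS refl])
      also have "\<dots> = W (Y y + P ?w - (fst y, 0))" by (rule W.diff[symmetric])
      also have "Y y + P ?w - (fst y, 0) = (0, (1 / c) *\<^sub>R snd y + \<epsilon> *\<^sub>C snd ?w)" by (simp add: Y_def P_def)
      finally have "norm (?w - W (fst y, 0)) \<le> N * norm (0 :: L2, (1 / c) *\<^sub>R snd y + \<epsilon> *\<^sub>C snd ?w)" by (simp only: W(2))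
      also have "norm (0 :: L2, (1 / c) *\<^sub>R snd y + \<epsilon> *\<^sub>C snd ?w) \<le> 1 / c * norm y + cmod \<epsilon> * (4 * N * norm y)"
      proof -
        have "norm (0 :: L2, (1 / c) *\<^sub>R snd y + \<epsilon> *\<^sub>C snd ?w) \<le> norm ((1 / c) *\<^sub>R snd y) + norm (\<epsilon> *\<^sub>C snd ?w)"
          using norm_triangle_ineq[of "(1 / c) *\<^sub>R snd y" "\<epsilon> *\<^sub>C snd ?w"] by simp
        also have "norm ((1 / c) *\<^sub>R snd y) \<le> 1 / c * norm y"
          using c norm_snd_le[of "snd y" "fst y"] by (simp add: divide_right_mono)
        also have "norm (\<epsilon> *\<^sub>C snd ?w) \<le> cmod \<epsilon> * (4 * N * norm y)"
          unfolding norm_scaleC using norm_snd_le[of "snd ?w" "fst ?w"] Jb[of y] by (intro mult_left_mono) auto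
        finally show ?thesis by simp
      qed
      finally have 1: "norm (?w - W (fst y, 0)) \<le> N * (1 / c * norm y + cmod \<epsilon> * (4 * N * norm y))"
        using N by simp
      have 2: "norm ((1 / (2 * m * c)) *\<^sub>R snd ?w) \<le> 1 / (2 * m * c) * (4 * N * norm y)"
      proof -
        have "norm (snd ?w) \<le> 4 * N * norm y" using norm_snd_le[of "snd ?w" "fst ?w"] Jb[of y] by auto
        then have "\<bar>1 / (2 * m * c)\<bar> * norm (snd ?w) \<le> \<bar>1 / (2 * m * c)\<bar> * (4 * N * norm y)" by (rule mult_left_mono) simp
        then show ?thesis using m c by simp
      qed
      have "norm (?S y - (?R (fst y), 0)) \<le> norm (fst (?w - W (fst y, 0))) + norm ((1 / (2 * m * c)) *\<^sub>R snd ?w)"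
        unfolding eq by (rule norm_Pair_le)
      also have "norm (fst (?w - W (fst y, 0))) \<le> norm (?w - W (fst y, 0))"
        by (rule norm_fst_le_norm)
      also have "norm (?w - W (fst y, 0)) \<le> N * (1 / c * norm y + cmod \<epsilon> * (4 * N * norm y))" by (rule 1)
      also note 2
      finally have "norm (?S y - (?R (fst y), 0)) \<le> N * (1 / c * norm y + cmod \<epsilon> * (4 * N * norm y)) + 1 / (2 * m * c) * (4 * N * norm y)"
        by simp
      also have "\<dots> = (N * (1 / c + cmod \<epsilon> * (4 * N)) + 1 / (2 * m * c) * (4 * N)) * norm y" by (simp add: algebra_simps)
      finally show ?thesis unfolding \<epsilon> .
    qed
    have bl: "bounded_linear ?S"
    proof (rule bounded_linear_intro)
      fix x y :: "L2 \<times> L2" and r :: real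
      have lin: "J (a + b) = J a + J b" "J (r *\<^sub>R a) = r *\<^sub>R J a" "Y (a + b) = Y a + Y b" "Y (r *\<^sub>R a) = r *\<^sub>R Y a"
        "P (a + b) = P a + P b" "P (r *\<^sub>R a) = r *\<^sub>R P a" for a b
        by (auto simp: J_def Y_def P_def scaleR_add_right scaleC_add_right scaleR_scaleC scaleC_prod_def mult_ac)
      have "J (?S x + ?S y) = W (Y (x + y) + P (J (?S x + ?S y)))"
      proof -
        have "J (?S x + ?S y) = W (Y x + P (J (?S x))) + W (Y y + P (J (?S y)))"
          unfolding lin by (rule arg_cong2[where f = "(+)", OF JS JS])
        also have "\<dots> = W (Y (x + y) + P (J (?S x + ?S y)))" by (simp only: lin add_ac flip: W.add)
        finally show ?thesis .
      qed
      from SJ[OF this] show "?S (x + y) = ?S x + ?S y" by (rule sym)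
      have "J (r *\<^sub>R ?S x) = W (Y (r *\<^sub>R x) + P (J (r *\<^sub>R ?S x)))"
      proof -
        have "J (r *\<^sub>R ?S x) = r *\<^sub>R W (Y x + P (J (?S x)))" unfolding lin by (rule arg_cong[where f = "scaleR r", OF JS])
        also have "\<dots> = W (Y (r *\<^sub>R x) + P (J (r *\<^sub>R ?S x)))" by (simp only: lin scaleR_add_right flip: W.scaleR)
        finally show ?thesis .
      qed
      from SJ[OF this] show "?S (r *\<^sub>R x) = r *\<^sub>R ?S x" by (rule sym)
      have "?S x = (fst (J (?S x)), (1 / (2 * m * c)) *\<^sub>R snd (J (?S x)))" by (rule Jinj[THEN iffD1]) (rule refl)
      then have "norm (?S x) = norm (fst (J (?S x)), (1 / (2 * m * c)) *\<^sub>R snd (J (?S x)))" by (rule arg_cong)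
      also have "\<dots> \<le> norm (fst (J (?S x))) + norm ((1 / (2 * m * c)) *\<^sub>R snd (J (?S x)))" by (rule norm_Pair_le)
      also have "\<dots> \<le> norm (J (?S x)) + \<bar>1 / (2 * m * c)\<bar> * norm (J (?S x))"
        unfolding norm_scaleR by (intro add_mono mult_left_mono norm_fst_le_norm norm_snd_le_norm) auto
      also have "\<dots> = (1 + \<bar>1 / (2 * m * c)\<bar>) * norm (J (?S x))" by (simp add: distrib_right)
      also have "\<dots> \<le> (1 + \<bar>1 / (2 * m * c)\<bar>) * (4 * N * norm x)" by (intro mult_left_mono Jb) auto
      finally show "norm (?S x) \<le> norm x * ((1 + \<bar>1 / (2 * m * c)\<bar>) * (4 * N))" by (simp add: mult_ac)
    qed
    show "z \<in> resolvent_set (minus_scalar (dirac_op m \<alpha> c) (complex_of_real (m * c\<^sup>2)))"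
      unfolding A_def[symmetric] resolvent_set_def using bij bl by simp
    fix \<psi>
    show "norm (resolvent (minus_scalar (dirac_op m \<alpha> c) (complex_of_real (m * c\<^sup>2))) z \<psi>
             - (?R (fst \<psi>), 0))
       \<le> (N * (1 / c + cmod z / (2 * m * c\<^sup>2) * (4 * N)) + 1 / (2 * m * c) * (4 * N)) * norm \<psi>"
      unfolding A_def[symmetric] by (rule est)
  qed
qed

theorem theorem5p1:
  fixes \<alpha> m :: real and z :: complex
  assumes "0 < \<alpha>" and "\<alpha> < pi / 2" and "0 < m"
    and "z \<in> resolvent_set (robin_laplacian m (2 * cot \<alpha>))"
  shows "(\<forall>\<^sub>F c in at_top.
            z \<in> resolvent_set (minus_scalar (dirac_op m \<alpha> c) (complex_of_real (m * c\<^sup>2)))) \<and>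
         ((\<lambda>c. onorm (\<lambda>\<psi>.
             resolvent (minus_scalar (dirac_op m \<alpha> c) (complex_of_real (m * c\<^sup>2))) z \<psi>
             - (resolvent (robin_laplacian m (2 * cot \<alpha>)) z (fst \<psi>), 0))) \<longlongrightarrow> 0) at_top"
proof -
  let ?A = "\<lambda>c. minus_scalar (dirac_op m \<alpha> c) (complex_of_real (m * c\<^sup>2))"
  let ?R = "resolvent (robin_laplacian m (2 * cot \<alpha>)) z"
  let ?D = "\<lambda>c \<psi>. resolvent (?A c) z \<psi> - (?R (fst \<psi>), 0)"
  have cot: "0 < cot \<alpha>" using assms(1,2) by (intro cot_gt_zero) auto
  obtain N where N: "0 < N" and est: "\<And>c. 1 \<le> c \<Longrightarrow> N * (cmod z / (2 * m * c\<^sup>2)) \<le> 1 / 2 \<Longrightarrow>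
     z \<in> resolvent_set (?A c) \<and> (\<forall>\<psi>. norm (?D c \<psi>)
       \<le> (N * (1 / c + cmod z / (2 * m * c\<^sup>2) * (4 * N)) + 1 / (2 * m * c) * (4 * N)) * norm \<psi>)"
    using dirac_resolvent_estimate[OF assms(3) cot assms(4)] by blast
  let ?K = "\<lambda>c. N * (1 / c + cmod z / (2 * m * c\<^sup>2) * (4 * N)) + 1 / (2 * m * c) * (4 * N)"
  have inv: "((\<lambda>c::real. 1 / c) \<longlongrightarrow> 0) at_top"
    using tendsto_inverse_0_at_top[OF filterlim_ident] by (simp add: inverse_eq_divide)
  have eps: "((\<lambda>c. cmod z / (2 * m * c\<^sup>2)) \<longlongrightarrow> 0) at_top"
  proof -
    have "((\<lambda>c. cmod z / (2 * m) * (1 / c * (1 / c))) \<longlongrightarrow> cmod z / (2 * m) * (0 * 0)) at_top"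
      by (intro tendsto_intros inv)
    then show ?thesis by (simp add: power2_eq_square)
  qed
  have K: "(?K \<longlongrightarrow> 0) at_top"
  proof -
    have "((\<lambda>c. N * (1 / c + cmod z / (2 * m * c\<^sup>2) * (4 * N)) + (1 / (2 * m)) * (1 / c) * (4 * N))
       \<longlongrightarrow> N * (0 + 0 * (4 * N)) + (1 / (2 * m)) * 0 * (4 * N)) at_top"
      by (intro tendsto_intros inv eps)
    then show ?thesis by simp
  qed
  have "((\<lambda>c. N * (cmod z / (2 * m * c\<^sup>2))) \<longlongrightarrow> N * 0) at_top" by (intro tendsto_intros eps)
  from order_tendstoD(2)[OF this, of "1 / 2"] have "\<forall>\<^sub>F c in at_top. N * (cmod z / (2 * m * c\<^sup>2)) < 1 / 2" by simp
  then have ev: "\<forall>\<^sub>F c in at_top. z \<in> resolvent_set (?A c) \<and> (\<forall>\<psi>. norm (?D c \<psi>) \<le> ?K c * norm \<psi>) \<and> 0 \<le> ?K c"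
    using eventually_ge_at_top[of 1]
  proof eventually_elim
    case (elim c)
    then show ?case using est[of c] N assms(3) by simp
  qed
  have on: "\<forall>\<^sub>F c in at_top. norm (onorm (?D c)) \<le> ?K c"
    using ev
  proof eventually_elim
    case (elim c)
    have "bounded_linear (resolvent (?A c) z)" "bounded_linear ?R"
      using elim assms(4) by (auto simp: resolvent_set_def)
    then have "bounded_linear (?D c)"
      by (intro bounded_linear_sub bounded_linear_Pair bounded_linear_compose[of ?R fst] bounded_linear_fst bounded_linear_zero)
    then have "0 \<le> onorm (?D c)" by (rule onorm_pos_le)
    moreover have "onorm (?D c) \<le> ?K c" by (rule onorm_bound) (use elim in blast)+
    ultimately show ?case by simp
  qed
  have "\<forall>\<^sub>F c in at_top. z \<in> resolvent_set (?A c)" using ev by (rule eventually_mono) blast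
  moreover have "((\<lambda>c. onorm (?D c)) \<longlongrightarrow> 0) at_top" by (rule Lim_null_comparison[OF on K])
  ultimately show ?thesis by blast
qed

end
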